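(* Let $\mathbf{k}$ be a field of characteristic $p>0$ and let $\sigma\subseteq N_{\mathbb{R}}$ be a nonzero strongly convex rational cone. Then for every Demazure root $e\in\operatorname{Rt}\sigma$ with distinguished ray $\rho$, every integer $r\in\mathbb{Z}_{\ge0}$ and every scalar $\lambda\in\mathbf{k}^*$, there is a non-trivial rationally homogeneous LFIHD $\partial$ on the algebra $\mathbf{k}[\sigma^\vee_M]$ whose exponential is given by $$e^{x\partial}(\chi^m)=\sum_{i=0}^{\infty}\binom{\langle m,\rho\rangle}{i}\lambda^i\,\chi^{m+ie}x^{ip^r}\quad\text{for all } m\in\sigma^\vee_M .$$ Conversely, every non-trivial rationally homogeneous LFIHD on $\mathbf{k}[\sigma^\vee_M]$ arises in this way.
   Context: $\mathbb{T}\simeq\mathbb{G}_{\mathrm m}^n$ is a split torus over $\mathbf{k}$, $M$ its character lattice, $N$ its lattice of one-parameter subgroups, $M_{\mathbb{R}}=M\otimes\mathbb{R}$, $N_{\mathbb{R}}=N\otimes\mathbb{R}$, with duality pairing $\langle m,v\rangle$. A rational cone in $N_{\mathbb R}$ is a cone generated by a finite subset of $N$; it is strongly convex if $0$ is a face. $\sigma^\vee\subseteq M_{\mathbb{R}}$ is the dual cone, $\sigma^\vee_M=\sigma^\vee\cap M$, $\mathbf{k}[\sigma^\vee_M]=\bigoplus_{m\in\sigma^\vee_M}\mathbf{k}\chi^m$ with $\chi^m\chi^{m'}=\chi^{m+m'}$, $\chi^0=1$. $\sigma(1)$ is the set of extremal rays, each identified with its primitive vector in $N$. $e\in M$ is a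 Demazure root of $\sigma$ ($e\in\operatorname{Rt}\sigma$) if there is $\rho\in\sigma(1)$ (the distinguished ray of $e$) with $\langle e,\rho\rangle=-1$ and $\langle e,\rho'\rangle\ge0$ for all $\rho'\in\sigma(1)\setminus\{\rho\}$. An LFIHD on a $\mathbf{k}$-algebra $A$ is a sequence $\partial=\{\partial^{(i)}\}_{i\ge0}$ of $\mathbf{k}$-linear operators with $\partial^{(0)}=\mathrm{id}$; $\partial^{(i)}(fg)=\sum_{j=0}^i\partial^{(j)}(f)\partial^{(i-j)}(g)$; for each $f\in A$, $\partial^{(i)}(f)=0$ for all large $i$; $\partial^{(i)}\circ\partial^{(j)}=\binom{i+j}{i}\partial^{(i+j)}$. Its exponential is $e^{x\partial}=\sum_{i\ge 0}\partial^{(i)}x^i$. It is non-trivial if $\ker\partial=\{f:\partial^{(i)}(f)=0\ \forall i>0\}\neq A$. On an $M$-graded algebra over a field of characteristic $p>0$, $\partial$ is rationally homogeneous (of degree $e/p^r$, with $e\in M$, $r\in\mathbb{Z}_{\ge0}$) if $\partial^{(ip^r)}$ maps the piece of degree $m$ into the piece of degree $m+ie$ for all $i\ge0$, $m\in M$, and $\partial^{(j)}=0$ whenever $p^r$ does not divide $j$. Convention: $\binom{r_1}{r_2}=0$ for $0\le r_1<r_2$. *)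

theory Defs
  imports
    "HOL-Analysis.Analysis"
    "HOL-Library.Poly_Mapping"
    "HOL-Computational_Algebra.Polynomial"
begin

text \<open>
  A splitting of the torus identifies the character lattice \<open>M\<close> and its dual lattice \<open>N\<close> with
  \<open>int ^ 'n\<close>, and \<open>M\<^sub>\<real>\<close> and \<open>N\<^sub>\<real>\<close> with \<open>real ^ 'n\<close>. The duality pairing is then
  \<^const>\<open>scalar_product\<close> on the lattices and the inner product \<open>\<bullet>\<close> on the real spaces.
\<close>

definition real_vec :: "int ^ 'n \<Rightarrow> real ^ 'n" where
  "real_vec v = (\<chi> i. of_int (v $ i))"


subsection \<open>Cones, extremal rays and Demazure roots\<close>

definition rational_cone :: "(real ^ 'n) set \<Rightarrow> bool" where
  "rational_cone \<sigma> \<longleftrightarrow> (\<exists>S. finite S \<and> \<sigma> = convex_cone hull (real_vec ` S))"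

definition strongly_convex :: "(real ^ 'n) set \<Rightarrow> bool" where
  "strongly_convex \<sigma> \<longleftrightarrow> {0} face_of \<sigma>"

definition dual_cone :: "(real ^ 'n) set \<Rightarrow> (real ^ 'n) set" where
  "dual_cone \<sigma> = {u. \<forall>v\<in>\<sigma>. 0 \<le> u \<bullet> v}"

definition dual_monoid :: "(real ^ 'n) set \<Rightarrow> (int ^ 'n) set" where
  "dual_monoid \<sigma> = {m. real_vec m \<in> dual_cone \<sigma>}"

text \<open>The zero vector is not primitive, since \<open>0 = 2 *s 0\<close>.\<close>

definition primitive :: "int ^ 'n \<Rightarrow> bool" where
  "primitive v \<longleftrightarrow> (\<forall>c w. v = c *s w \<longrightarrow> is_unit c)"

text \<open>The set \<open>\<sigma>(1)\<close>: each one-dimensional face is represented by its primitive lattice vector.\<close>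

definition extremal_rays :: "(real ^ 'n) set \<Rightarrow> (int ^ 'n) set" where
  "extremal_rays \<sigma> = {\<rho>. primitive \<rho> \<and> (\<exists>F. F edge_of \<sigma> \<and> real_vec \<rho> \<in> F)}"

definition distinguished_ray :: "(real ^ 'n) set \<Rightarrow> int ^ 'n \<Rightarrow> int ^ 'n \<Rightarrow> bool" where
  "distinguished_ray \<sigma> e \<rho> \<longleftrightarrow>
     \<rho> \<in> extremal_rays \<sigma> \<and> scalar_product e \<rho> = -1 \<and>
     (\<forall>\<rho>'\<in>extremal_rays \<sigma> - {\<rho>}. 0 \<le> scalar_product e \<rho>')"

definition demazure_roots :: "(real ^ 'n) set \<Rightarrow> (int ^ 'n) set" where
  "demazure_roots \<sigma> = {e. \<exists>\<rho>. distinguished_ray \<sigma> e \<rho>}"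


subsection \<open>The semigroup algebra of the dual cone\<close>

text \<open>
  The algebra \<open>k[\<sigma>\<^sup>\<or>\<^sub>M]\<close> is the subalgebra of the group algebra \<open>k[M]\<close> (finitely supported functions
  \<open>M \<Rightarrow> k\<close> with convolution) of elements supported in \<^term>\<open>dual_monoid \<sigma>\<close>.
\<close>

definition cone_algebra :: "(real ^ 'n) set \<Rightarrow> ((int ^ 'n) \<Rightarrow>\<^sub>0 'k::field) set" where
  "cone_algebra \<sigma> = {f. Poly_Mapping.keys f \<subseteq> dual_monoid \<sigma>}"

definition character :: "int ^ 'n \<Rightarrow> (int ^ 'n) \<Rightarrow>\<^sub>0 'k::field" where
  "character m = Poly_Mapping.single m 1"

definition scale :: "'k::field \<Rightarrow> ((int ^ 'n) \<Rightarrow>\<^sub>0 'k) \<Rightarrow> ((int ^ 'n) \<Rightarrow>\<^sub>0 'k)" where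
  "scale c f = Poly_Mapping.single 0 c * f"

definition graded_piece :: "(real ^ 'n) set \<Rightarrow> int ^ 'n \<Rightarrow> ((int ^ 'n) \<Rightarrow>\<^sub>0 'k::field) set" where
  "graded_piece \<sigma> m = {f \<in> cone_algebra \<sigma>. Poly_Mapping.keys f \<subseteq> {m}}"


subsection \<open>Locally finite iterative higher derivations\<close>

text \<open>
  Here \<open>A\<close> is a subset of a ring that is a \<open>k\<close>-algebra under the scalar multiplication \<open>sc\<close>.
  Operators are total functions of which only the restrictions to \<open>A\<close> matter.
\<close>

definition lfihd ::
    "('k::field \<Rightarrow> 'a::comm_ring_1 \<Rightarrow> 'a) \<Rightarrow> 'a set \<Rightarrow> (nat \<Rightarrow> 'a \<Rightarrow> 'a) \<Rightarrow> bool" where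
  "lfihd sc A d \<longleftrightarrow>
     (\<forall>i. \<forall>f\<in>A. d i f \<in> A) \<and>
     (\<forall>i. \<forall>f\<in>A. \<forall>g\<in>A. d i (f + g) = d i f + d i g) \<and>
     (\<forall>i c. \<forall>f\<in>A. d i (sc c f) = sc c (d i f)) \<and>
     (\<forall>f\<in>A. d 0 f = f) \<and>
     (\<forall>i. \<forall>f\<in>A. \<forall>g\<in>A. d i (f * g) = (\<Sum>j=0..i. d j f * d (i - j) g)) \<and>
     (\<forall>f\<in>A. \<exists>n. \<forall>i\<ge>n. d i f = 0) \<and>
     (\<forall>i j. \<forall>f\<in>A. d i (d j f) = of_nat ((i + j) choose i) * d (i + j) f)"

definition hd_kernel :: "'a::zero set \<Rightarrow> (nat \<Rightarrow> 'a \<Rightarrow> 'a) \<Rightarrow> 'a set" where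
  "hd_kernel A d = {f \<in> A. \<forall>i>0. d i f = 0}"

definition nontrivial_hd :: "'a::zero set \<Rightarrow> (nat \<Rightarrow> 'a \<Rightarrow> 'a) \<Rightarrow> bool" where
  "nontrivial_hd A d \<longleftrightarrow> hd_kernel A d \<noteq> A"

text \<open>
  The exponential of \<open>f\<close> as a polynomial in \<open>x\<close>. \<^const>\<open>Sum_any\<close> sums over all \<open>i\<close> with nonzero
  summand, of which there are finitely many when \<open>d\<close> is locally finite.
\<close>

definition hd_exp :: "(nat \<Rightarrow> 'a \<Rightarrow> 'a) \<Rightarrow> 'a \<Rightarrow> 'a::comm_ring_1 poly" where
  "hd_exp d f = Sum_any (\<lambda>i. monom (d i f) i)"

definition rationally_homogeneous_of_degree ::
    "(real ^ 'n) set \<Rightarrow> int ^ 'n \<Rightarrow> nat \<Rightarrow>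
     (nat \<Rightarrow> ((int ^ 'n) \<Rightarrow>\<^sub>0 'k::field) \<Rightarrow> ((int ^ 'n) \<Rightarrow>\<^sub>0 'k)) \<Rightarrow> bool" where
  "rationally_homogeneous_of_degree \<sigma> e r d \<longleftrightarrow>
     (\<forall>i m. \<forall>f\<in>graded_piece \<sigma> m. d (i * CHAR('k) ^ r) f \<in> graded_piece \<sigma> (m + int i *s e)) \<and>
     (\<forall>j. \<not> CHAR('k) ^ r dvd j \<longrightarrow> (\<forall>f\<in>cone_algebra \<sigma>. d j f = 0))"

definition rationally_homogeneous ::
    "(real ^ 'n) set \<Rightarrow>
     (nat \<Rightarrow> ((int ^ 'n) \<Rightarrow>\<^sub>0 'k::field) \<Rightarrow> ((int ^ 'n) \<Rightarrow>\<^sub>0 'k)) \<Rightarrow> bool" where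
  "rationally_homogeneous \<sigma> d \<longleftrightarrow> (\<exists>e r. rationally_homogeneous_of_degree \<sigma> e r d)"

text \<open>
  The prescribed exponential. The pairing \<open>\<langle>m, \<rho>\<rangle>\<close> is nonnegative for \<open>m\<close> in the dual monoid, so
  \<^const>\<open>nat\<close> does not truncate, and the summands vanish for \<open>i > \<langle>m, \<rho>\<rangle>\<close>.
\<close>

definition has_root_exponential ::
    "(real ^ 'n) set \<Rightarrow> int ^ 'n \<Rightarrow> int ^ 'n \<Rightarrow> nat \<Rightarrow> 'k::field \<Rightarrow>
     (nat \<Rightarrow> ((int ^ 'n) \<Rightarrow>\<^sub>0 'k) \<Rightarrow> ((int ^ 'n) \<Rightarrow>\<^sub>0 'k)) \<Rightarrow> bool" where
  "has_root_exponential \<sigma> e \<rho> r c d \<longleftrightarrow>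
     (\<forall>m\<in>dual_monoid \<sigma>.
        hd_exp d (character m) =
        Sum_any (\<lambda>i. monom
          (scale (of_nat (nat (scalar_product m \<rho>) choose i) * c ^ i) (character (m + int i *s e)))
          (i * CHAR('k) ^ r)))"

end

theory Submission
  imports Defs
begin

text \<open>
  The exponential of a homogeneous operator multiplies each character by a polynomial, up to a shift of
  degree: \<open>\<chi>\<^sup>m\<close> goes to the sum of the terms \<open>b\<^sub>k(m) \<chi>\<^bsup>m + (k/q) e\<^esup> x\<^sup>k\<close> with \<open>q = p\<^sup>r\<close>. Write \<open>E m\<close> for the
  polynomial with coefficients \<open>b\<^sub>k(m)\<close>. The Leibniz rule says that \<open>E\<close> is multiplicative on the dual monoid,
  and the prescribed exponentials are those with \<open>E m = (1 + c x\<^sup>q)\<close> to the power \<open>\<langle>m, \<rho>\<rangle>\<close>.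

  To see that such an \<open>E\<close> defines an LFIHD, two points need an argument. The shifted characters must remain
  in the algebra; this holds because the cone is generated by its extremal rays
  (\<open>mem_dual_monoid_if_nonneg_on_rays\<close>, \<open>root_translate_mem\<close>). The iteration rule involves binomial
  coefficients of multiples of \<open>q\<close>, which are governed by Frobenius
  (\<open>binomial_char_power_multiple\<close>, \<open>root_operator_lfihd\<close>).

  Conversely, let \<open>E\<close> come from a nontrivial LFIHD. Degrees of polynomials over a field are additive, so
  \<open>degree (E m) = q \<langle>m, v\<rangle>\<close> for some \<open>v \<in> N\<close>. By the iteration rule nothing survives after the operator of
  top order, so \<open>E\<close> is trivial at \<open>m + \<langle>m, v\<rangle> e\<close>; hence \<open>\<langle>e, v\<rangle> = -1\<close>, and \<open>v\<close> is primitive. The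
  map \<open>m \<mapsto> m + \<langle>m, v\<rangle> e\<close> preserves the dual monoid, so its transpose, which kills \<open>v\<close>, preserves the
  cone; strong convexity then forces \<open>v\<close> to span an extremal ray and \<open>e\<close> to be nonnegative on all others
  (\<open>distinguished_ray_criterion\<close>). Since \<open>E\<close> is trivial on the image of that map, it factors through
  \<open>\<langle>m, v\<rangle>\<close> and is determined by a polynomial \<open>1 + c x\<^sup>q\<close> (\<open>lfihd_has_root_exponential\<close>).
\<close>

section \<open>Lattice vectors\<close>

lemma real_vec_inner: "real_vec m \<bullet> real_vec v = of_int (scalar_product m v)"
  by (simp add: real_vec_def scalar_product_def inner_vec_def)

lemma real_vec_add: "real_vec (a + b) = real_vec a + real_vec b"
  by (simp add: real_vec_def vec_eq_iff)

lemma real_vec_scale: "real_vec (c *s a) = of_int c *\<^sub>R real_vec a"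
  by (simp add: real_vec_def vec_eq_iff)

lemma real_vec_eq_iff: "real_vec a = real_vec b \<longleftrightarrow> a = b"
  by (simp add: real_vec_def vec_eq_iff)

lemma real_vec_0 [simp]: "real_vec 0 = 0"
  by (simp add: real_vec_def vec_eq_iff)

lemma real_vec_eq_0_iff [simp]: "real_vec a = 0 \<longleftrightarrow> a = 0"
  using real_vec_eq_iff[of a 0] by simp

lemma scalar_product_add_left: "scalar_product (a + b) (v :: int ^ 'n) = scalar_product a v + scalar_product b v"
  by (simp add: scalar_product_def algebra_simps sum.distrib)

lemma scalar_product_scale_left: "scalar_product (c *s a) (v :: int ^ 'n) = c * scalar_product a v"
  by (simp add: scalar_product_def algebra_simps sum_distrib_left)

lemma scalar_product_scale_right: "scalar_product a (c *s v :: int ^ 'n) = c * scalar_product a v"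
  by (simp add: scalar_product_def algebra_simps sum_distrib_left)

text \<open>
  Rational points are dense, and an open cone absorbs the denominators.
\<close>

lemma open_cone_contains_lattice_point:
  fixes U :: "(real ^ 'n) set"
  assumes "open U" "U \<noteq> {}" and scale: "\<And>x c. x \<in> U \<Longrightarrow> 0 < c \<Longrightarrow> c *\<^sub>R x \<in> U"
  shows "\<exists>m. real_vec m \<in> U"
proof -
  let ?D = "\<Union>k. \<Union>f \<in> Basis \<rightarrow> \<int>. {\<Sum>i::real ^ 'n \<in> Basis. (f i / 2^k) *\<^sub>R i}"
  have "U \<inter> closure ?D \<noteq> {}"
    using assms(2) by (simp add: closure_dyadic_rationals)
  then have "U \<inter> ?D \<noteq> {}"
    using open_Int_closure_eq_empty[OF assms(1)] by blast
  then obtain k :: nat and f where f: "f \<in> Basis \<rightarrow> \<int>"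
    and U: "(\<Sum>i::real ^ 'n \<in> Basis. (f i / 2^k) *\<^sub>R i) \<in> U"
    by blast
  define m :: "int ^ 'n" where "m = (\<chi> i. \<lfloor>f (axis i 1)\<rfloor>)"
  have "2 ^ k *\<^sub>R (\<Sum>i::real ^ 'n \<in> Basis. (f i / 2^k) *\<^sub>R i) = (\<Sum>i \<in> Basis. f i *\<^sub>R i)"
    by (simp add: scaleR_sum_right)
  also have "\<dots> = real_vec m"
  proof (rule vec_eq_iff[THEN iffD2], rule)
    fix i :: 'n
    have B: "axis i 1 \<in> (Basis :: (real ^ 'n) set)" by (simp add: axis_in_Basis_iff)
    have "(\<Sum>b \<in> Basis. f b *\<^sub>R b) $ i = (\<Sum>b \<in> Basis. f b *\<^sub>R b) \<bullet> axis i 1"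
      by (simp add: inner_axis)
    also have "\<dots> = f (axis i 1)"
      using B by (rule inner_sum_left_Basis)
    also have "\<dots> = real_vec m $ i"
      using f B by (auto simp: real_vec_def m_def Pi_iff elim!: Ints_cases)
    finally show "(\<Sum>b \<in> Basis. f b *\<^sub>R b) $ i = real_vec m $ i" .
  qed
  finally show ?thesis
    using scale[OF U, of "2 ^ k"] by auto
qed

lemma lattice_vector_is_multiple_of_primitive:
  fixes v :: "int ^ 'n"
  assumes "v \<noteq> 0"
  obtains c w where "c > 0" "primitive w" "v = c *s w"
proof -
  define g where "g = (GCD i\<in>UNIV. v $ i)"
  obtain i where "v $ i \<noteq> 0"
    using assms by (auto simp: vec_eq_iff)
  moreover have gdvd: "g dvd v $ j" for j
    unfolding g_def by (rule Gcd_dvd) simp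
  moreover have "g \<ge> 0" unfolding g_def by simp
  ultimately have g: "g > 0" by (metis dvd_0_left order_le_less)
  define w where "w = (\<chi> i. v $ i div g)"
  have v: "v = g *s w"
    using gdvd by (simp add: vec_eq_iff w_def)
  have "is_unit c" if "w = c *s w'" for c w'
  proof -
    have "g * c dvd v $ j" for j
      using that v by simp
    then have "g * c dvd g"
      unfolding g_def by (intro Gcd_greatest) auto
    then show ?thesis using g by simp
  qed
  then show ?thesis
    using that[OF g _ v] by (auto simp: primitive_def)
qed

lemma primitive_if_pairing_is_minus_one:
  assumes "scalar_product e v = -1"
  shows "primitive v"
  unfolding primitive_def
proof (intro allI impI)
  fix c w assume "v = c *s w"
  then have "c * (- scalar_product e w) = 1"
    using assms by (simp add: scalar_product_scale_right)
  then show "is_unit c" by (metis dvd_triv_left)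
qed

lemma axis_expansion_int: "m = (\<Sum>i\<in>UNIV. m $ i *s axis i (1::int))"
  by (simp add: vec_eq_iff axis_def if_distrib[of "\<lambda>x. _ * x"] cong: if_cong)

text \<open>
  The dual lattice of \<open>M\<close> is \<open>N\<close>; this is where an additive function on characters becomes a vector
  of one-parameter subgroups.
\<close>

lemma additive_int_vec_eq_scalar_product:
  fixes g :: "int ^ 'n \<Rightarrow> int"
  assumes add: "\<And>a b. g (a + b) = g a + g b"
  shows "g m = scalar_product m (\<chi> i. g (axis i 1))"
proof -
  interpret Modules.additive g by standard (rule add)
  have nat: "g (int n *s a) = int n * g a" for n a
    by (induction n) (simp_all add: zero vector_sadd_rdistrib add algebra_simps)
  have scale: "g (k *s a) = k * g a" for k a
  proof (cases k rule: int_cases2)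
    case (nonpos n)
    have "(- int n) *s a = - (int n *s a)" by (simp add: vec_eq_iff)
    then show ?thesis using minus[of "int n *s a"] nonpos by (simp add: nat)
  qed (simp add: nat)
  have "g m = (\<Sum>i\<in>UNIV. g (m $ i *s axis i 1))"
    by (subst axis_expansion_int[of m]) (rule sum)
  then show ?thesis by (simp add: scale scalar_product_def)
qed

section \<open>The dual monoid\<close>

lemma zero_mem_dual_monoid: "0 \<in> dual_monoid \<sigma>"
  by (simp add: dual_monoid_def dual_cone_def real_vec_def inner_vec_def)

lemma dual_monoid_nonneg: "m \<in> dual_monoid \<sigma> \<Longrightarrow> x \<in> \<sigma> \<Longrightarrow> 0 \<le> real_vec m \<bullet> x"
  by (simp add: dual_monoid_def dual_cone_def)

lemma dual_monoid_add: "a \<in> dual_monoid \<sigma> \<Longrightarrow> b \<in> dual_monoid \<sigma> \<Longrightarrow> a + b \<in> dual_monoid \<sigma>"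
  by (simp add: dual_monoid_def dual_cone_def real_vec_add inner_add_left)

lemma dual_monoid_scale: "m \<in> dual_monoid \<sigma> \<Longrightarrow> 0 \<le> c \<Longrightarrow> c *s m \<in> dual_monoid \<sigma>"
  by (simp add: dual_monoid_def dual_cone_def real_vec_scale)

lemma mem_dual_monoid_if_positive:
  assumes "\<And>x. x \<in> \<sigma> \<Longrightarrow> x \<noteq> 0 \<Longrightarrow> 0 < real_vec m \<bullet> x"
  shows "m \<in> dual_monoid \<sigma>"
proof -
  have "0 \<le> real_vec m \<bullet> x" if "x \<in> \<sigma>" for x
    using assms[OF that] by (cases "x = 0") (auto simp: less_imp_le)
  then show ?thesis by (simp add: dual_monoid_def dual_cone_def)
qed

section \<open>Strongly convex rational cones\<close>

locale strongly_convex_rational_cone =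
  fixes \<sigma> :: "(real ^ 'n) set"
  assumes rational: "rational_cone \<sigma>" and strongly_convex: "strongly_convex \<sigma>"
begin

lemma convex_cone: "convex_cone \<sigma>"
  using rational by (auto simp: rational_cone_def convex_cone_convex_cone_hull)

lemma closed: "closed \<sigma>"
  using rational by (auto simp: rational_cone_def intro: closed_convex_cone_hull)

lemmas add_mem = convex_cone_add[OF convex_cone]
lemmas scale_mem = convex_cone_scaleR[OF convex_cone]
lemmas zero_mem = convex_cone_contains_0[OF convex_cone]

lemma generators:
  obtains S where "finite S" "0 \<notin> S" "\<sigma> = convex_cone hull (real_vec ` S)"
proof -
  obtain S where S: "finite S" "\<sigma> = convex_cone hull (real_vec ` S)"
    using rational by (auto simp: rational_cone_def)
  have "convex_cone hull (real_vec ` S) = convex_cone hull (real_vec ` (S - {0}))"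
  proof
    have "real_vec ` S \<subseteq> insert 0 (real_vec ` (S - {0}))" by auto
    also have "\<dots> \<subseteq> convex_cone hull (real_vec ` (S - {0}))"
      by (simp add: convex_cone_hull_contains_0 hull_subset)
    finally show "convex_cone hull (real_vec ` S) \<subseteq> convex_cone hull (real_vec ` (S - {0}))"
      by (simp add: hull_minimal convex_cone_convex_cone_hull)
  qed (auto intro!: hull_mono)
  then show ?thesis
    using S that[of "S - {0}"] by simp
qed

lemma sum_eq_0_imp_eq_0:
  assumes "a \<in> \<sigma>" "b \<in> \<sigma>" "a + b = 0"
  shows "a = 0"
proof (rule ccontr)
  assume "a \<noteq> 0"
  have b: "b = - a" using assms(3) by (simp add: eq_neg_iff_add_eq_0 add.commute)
  have "0 \<in> open_segment a b"
    unfolding in_segment b using \<open>a \<noteq> 0\<close>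
    by (auto intro!: exI[of _ "1/2::real"] simp: eq_neg_iff_add_eq_0 simp flip: scaleR_2)
  with assms strongly_convex show False
    using \<open>a \<noteq> 0\<close> by (auto simp: strongly_convex_def face_of_def)
qed

lemma nonneg_if_nonneg_on_generators:
  assumes "\<sigma> = convex_cone hull (real_vec ` S)" "\<And>s. s \<in> S \<Longrightarrow> 0 \<le> u \<bullet> real_vec s" "x \<in> \<sigma>"
  shows "0 \<le> u \<bullet> x"
proof -
  have "\<sigma> \<subseteq> {x. u \<bullet> x \<ge> 0}"
    unfolding assms(1) using assms(2) by (intro hull_minimal convex_cone_halfspace_ge) auto
  then show ?thesis using assms(3) by auto
qed

lemma pos_if_pos_on_generators:
  assumes "\<sigma> = convex_cone hull (real_vec ` S)" "\<And>s. s \<in> S \<Longrightarrow> 0 < u \<bullet> real_vec s" "x \<in> \<sigma>" "x \<noteq> 0"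
  shows "0 < u \<bullet> x"
proof -
  have "convex hull (real_vec ` S) \<subseteq> {x. u \<bullet> x > 0}"
    using assms(2) by (intro hull_minimal convex_halfspace_gt) auto
  moreover obtain c y where "x = c *\<^sub>R y" "y \<in> convex hull (real_vec ` S)" "c \<ge> 0"
    using assms(3,4) unfolding assms(1) convex_cone_hull_convex_hull by auto
  ultimately show ?thesis using \<open>x \<noteq> 0\<close> by auto
qed

text \<open>
  Strong convexity enters here: it keeps the origin out of the convex hull of the nonzero generators,
  so a hyperplane separates the two. In other words, the dual cone has nonempty interior.
\<close>

lemma positive_functional_exists: "\<exists>u. \<forall>x\<in>\<sigma>. x \<noteq> 0 \<longrightarrow> 0 < u \<bullet> x"
proof -
  obtain S where S: "finite S" "0 \<notin> S" "\<sigma> = convex_cone hull (real_vec ` S)"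
    by (rule generators)
  have S\<sigma>: "real_vec s \<in> \<sigma>" if "s \<in> S" for s
    using that S(3) by (simp add: hull_inc)
  have "0 \<notin> convex hull (real_vec ` S)"
  proof
    assume "0 \<in> convex hull (real_vec ` S)"
    then obtain c where c: "\<And>x. x \<in> real_vec ` S \<Longrightarrow> 0 \<le> c x" "sum c (real_vec ` S) = 1"
      "(\<Sum>x\<in>real_vec ` S. c x *\<^sub>R x) = 0"
      using S(1) by (auto simp: convex_hull_finite)
    obtain y where y: "y \<in> real_vec ` S" "c y > 0"
      using c(1,2) by (metis less_eq_real_def sum.neutral zero_neq_one)
    have mem: "(\<Sum>x\<in>X. c x *\<^sub>R x) \<in> \<sigma>" if "X \<subseteq> real_vec ` S" for X
      using finite_subset[OF that finite_imageI[OF S(1)]] that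
      by (induction X rule: finite_induct) (auto intro!: zero_mem add_mem scale_mem c(1) S\<sigma>)
    \<comment> \<open>A convex combination equal to \<open>0\<close> would write \<open>0\<close> as a sum of two elements of the cone, one of
      them a positive multiple of a generator.\<close>
    have "c y *\<^sub>R y + (\<Sum>x\<in>real_vec ` S - {y}. c x *\<^sub>R x) = 0"
      using c(3) S(1) y(1) by (simp add: sum.remove)
    moreover have "c y *\<^sub>R y \<in> \<sigma>"
      using y S\<sigma> by (auto intro!: scale_mem)
    ultimately have "c y *\<^sub>R y = 0"
      using mem[of "real_vec ` S - {y}"] sum_eq_0_imp_eq_0 by blast
    then show False
      using y S(2) by auto
  qed
  then obtain u b where "0 < b" "\<forall>x\<in>convex hull (real_vec ` S). b < u \<bullet> x"
    using separating_hyperplane_closed_0[of "convex hull (real_vec ` S)"] S(1)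
    by (metis convex_convex_hull compact_imp_closed finite_imageI finite_imp_compact_convex_hull)
  then have "0 < u \<bullet> real_vec s" if "s \<in> S" for s
    using that by (meson hull_inc imageI less_trans)
  then show ?thesis
    using pos_if_pos_on_generators[OF S(3)] by blast
qed

text \<open>
  Positivity on a finite generating set and on \<open>W\<close> is an open conic condition on \<open>u\<close>, hence can be
  achieved by a lattice vector as soon as it can be achieved at all. Taking \<open>W = {- w}\<close> gives characters
  that are negative at a prescribed point \<open>w\<close>.
\<close>

lemma lattice_point_in_open_dual_cone:
  assumes "\<And>x. x \<in> \<sigma> \<Longrightarrow> x \<noteq> 0 \<Longrightarrow> 0 < u \<bullet> x" "finite W" "\<And>w. w \<in> W \<Longrightarrow> 0 < u \<bullet> w"
  shows "\<exists>m. (\<forall>x\<in>\<sigma>. x \<noteq> 0 \<longrightarrow> 0 < real_vec m \<bullet> x) \<and> (\<forall>w\<in>W. 0 < real_vec m \<bullet> w)"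
proof -
  obtain S where S: "finite S" "0 \<notin> S" "\<sigma> = convex_cone hull (real_vec ` S)"
    by (rule generators)
  define U where "U = (\<Inter>w \<in> real_vec ` S \<union> W. {y. w \<bullet> y > 0})"
  have "open U"
    unfolding U_def using S(1) assms(2) by (intro open_INT ballI open_halfspace_gt) auto
  moreover have "0 < u \<bullet> real_vec s" if "s \<in> S" for s
  proof (rule assms(1))
    show "real_vec s \<in> \<sigma>" using that S(3) by (simp add: hull_inc)
    show "real_vec s \<noteq> 0" using that S(2) by auto
  qed
  then have "u \<in> U"
    using assms(3) by (auto simp: U_def inner_commute[of _ u])
  moreover have "c *\<^sub>R y \<in> U" if "y \<in> U" "0 < c" for c y
    using that by (auto simp: U_def)
  ultimately obtain m where "real_vec m \<in> U"
    using open_cone_contains_lattice_point by blast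
  then have m: "0 < w \<bullet> real_vec m" if "w \<in> real_vec ` S \<union> W" for w
    using that by (auto simp: U_def)
  have "0 < real_vec m \<bullet> x" if "x \<in> \<sigma>" "x \<noteq> 0" for x
    using m by (intro pos_if_pos_on_generators[OF S(3) _ that]) (simp add: inner_commute)
  moreover have "0 < real_vec m \<bullet> w" if "w \<in> W" for w
    using m[of w] that by (simp add: inner_commute)
  ultimately show ?thesis by blast
qed

lemma interior_character_exists:
  obtains m where "\<And>x. x \<in> \<sigma> \<Longrightarrow> x \<noteq> 0 \<Longrightarrow> 0 < real_vec m \<bullet> x"
proof -
  obtain u where u: "\<And>x. x \<in> \<sigma> \<Longrightarrow> x \<noteq> 0 \<Longrightarrow> 0 < u \<bullet> x"
    using positive_functional_exists by blast
  show ?thesis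
    using lattice_point_in_open_dual_cone[of u "{}", OF u] that by auto
qed

text \<open>
  Duality of cones, tested on lattice points only. A real separating functional exists since the cone
  is closed; it can be replaced by a character because the dual cone has interior points.
\<close>

lemma mem_if_nonneg_on_dual_monoid:
  assumes "\<And>m. m \<in> dual_monoid \<sigma> \<Longrightarrow> 0 \<le> real_vec m \<bullet> w"
  shows "w \<in> \<sigma>"
proof (rule ccontr)
  assume "w \<notin> \<sigma>"
  then obtain a b where ab: "a \<bullet> w < b" "\<And>x. x \<in> \<sigma> \<Longrightarrow> b < a \<bullet> x"
    using separating_hyperplane_closed_point[of \<sigma> w] closed convex_cone
    by (auto simp: convex_cone_def)
  have b: "b < 0" using ab(2)[OF zero_mem] by simp
  have a_nonneg: "0 \<le> a \<bullet> x" if "x \<in> \<sigma>" for x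
  proof (rule ccontr)
    assume neg: "\<not> 0 \<le> a \<bullet> x"
    then have "(b / (a \<bullet> x)) *\<^sub>R x \<in> \<sigma>"
      using b that by (intro scale_mem) (auto simp: divide_nonpos_nonpos)
    from ab(2)[OF this] neg show False by simp
  qed
  obtain u where u: "\<And>x. x \<in> \<sigma> \<Longrightarrow> x \<noteq> 0 \<Longrightarrow> 0 < u \<bullet> x"
    using positive_functional_exists by blast
  \<comment> \<open>Moving \<open>a\<close> slightly into the interior of the dual cone keeps it negative on \<open>w\<close>.\<close>
  obtain \<epsilon> where \<epsilon>: "\<epsilon> > 0" "\<epsilon> * (u \<bullet> w) < - (a \<bullet> w)"
  proof (cases "u \<bullet> w > 0")
    case True
    have neg: "- (a \<bullet> w) > 0" using ab(1) b by simp
    show ?thesis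
      using True neg by (intro that[of "- (a \<bullet> w) / (2 * (u \<bullet> w))"]) (simp_all add: field_simps)
  next
    case False
    then show ?thesis using that[of 1] ab(1) b by simp
  qed
  have pos: "0 < (a + \<epsilon> *\<^sub>R u) \<bullet> x" if "x \<in> \<sigma>" "x \<noteq> 0" for x
    using a_nonneg[OF that(1)] u[OF that] \<epsilon>(1) by (simp add: inner_add_left add_nonneg_pos)
  have neg: "0 < (a + \<epsilon> *\<^sub>R u) \<bullet> w'" if "w' \<in> {- w}" for w'
    using \<epsilon>(2) that by (simp add: inner_add_left)
  have "\<exists>m. (\<forall>x\<in>\<sigma>. x \<noteq> 0 \<longrightarrow> 0 < real_vec m \<bullet> x) \<and> (\<forall>w'\<in>{- w}. 0 < real_vec m \<bullet> w')"
    by (rule lattice_point_in_open_dual_cone[OF pos _ neg]) simp_all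
  then obtain m where m: "\<And>x. x \<in> \<sigma> \<Longrightarrow> x \<noteq> 0 \<Longrightarrow> 0 < real_vec m \<bullet> x" "0 < real_vec m \<bullet> (- w)"
    by blast
  have "m \<in> dual_monoid \<sigma>"
    using m(1) by (rule mem_dual_monoid_if_positive)
  then show False
    using assms[of m] m(2) by simp
qed

text \<open>
  A face is tested on segments through arbitrary points of the ray. In a cone such a segment rescales to
  a decomposition of the generator \<open>x\<close>, and strong convexity takes care of the origin.
\<close>

lemma ray_is_edge:
  assumes "x \<in> \<sigma>" "x \<noteq> 0" and decomp: "\<And>a b. a \<in> \<sigma> \<Longrightarrow> b \<in> \<sigma> \<Longrightarrow> a + b = x \<Longrightarrow> \<exists>t\<ge>0. a = t *\<^sub>R x"
  shows "(\<lambda>t. t *\<^sub>R x) ` {0..} edge_of \<sigma>" (is "?F edge_of _")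
proof -
  have memF: "a \<in> ?F" if "a \<in> \<sigma>" "b \<in> \<sigma>" "l > 0" "m > 0" "l *\<^sub>R a + m *\<^sub>R b = t *\<^sub>R x" "t \<ge> 0" for a b l m t
  proof (cases "t = 0")
    case True
    then have "l *\<^sub>R a + m *\<^sub>R b = 0" using that(5) by simp
    moreover have "l *\<^sub>R a \<in> \<sigma>" "m *\<^sub>R b \<in> \<sigma>"
      using that(1-4) by (auto intro: scale_mem)
    ultimately have "l *\<^sub>R a = 0"
      using sum_eq_0_imp_eq_0 by blast
    then show ?thesis using that(3) by (auto intro!: image_eqI[of _ _ 0])
  next
    case False
    then have t: "t > 0" using that by simp
    have "(l / t) *\<^sub>R a + (m / t) *\<^sub>R b = (1 / t) *\<^sub>R (l *\<^sub>R a + m *\<^sub>R b)"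
      by (simp add: scaleR_add_right)
    also have "\<dots> = x"
      using that(5) t by simp
    finally have "\<exists>s\<ge>0. (l / t) *\<^sub>R a = s *\<^sub>R x"
      using that t by (intro decomp[of _ "(m / t) *\<^sub>R b"] scale_mem) auto
    then obtain s where s: "s \<ge> 0" "(l / t) *\<^sub>R a = s *\<^sub>R x" by blast
    have "a = (t / l) *\<^sub>R ((l / t) *\<^sub>R a)" using t that(3) by simp
    also have "\<dots> = (t / l * s) *\<^sub>R x" unfolding s(2) by simp
    finally show ?thesis
      using s(1) t that(3) by (auto intro!: image_eqI[of _ _ "t / l * s"])
  qed
  have "?F face_of \<sigma>"
    unfolding face_of_def
  proof (intro conjI ballI impI)
    show "?F \<subseteq> \<sigma>" using assms(1) by (auto intro: scale_mem)
    show "convex ?F"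
      by (intro convex_linear_image bounded_linear.linear[OF bounded_linear_scaleR_left]) simp
    fix a b y assume *: "a \<in> \<sigma>" "b \<in> \<sigma>" "y \<in> ?F" "y \<in> open_segment a b"
    then obtain t u where "t \<ge> 0" "0 < u" "u < 1" "(1 - u) *\<^sub>R a + u *\<^sub>R b = t *\<^sub>R x"
      by (auto simp: in_segment)
    then show "a \<in> ?F" "b \<in> ?F"
      using memF[OF *(1,2), of "1 - u" u t] memF[OF *(2,1), of u "1 - u" t] by (auto simp: add.commute)
  qed
  moreover have "aff_dim ?F = 1"
  proof -
    have "0 \<in> ?F" by (auto intro: image_eqI[of _ _ 0])
    then have "aff_dim ?F = int (dim ?F)"
      by (intro aff_dim_zero hull_inc)
    moreover have "span ?F = span {x}"
    proof (rule subset_antisym)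
      show "span ?F \<subseteq> span {x}"
        by (rule span_minimal) (auto intro: span_scale span_base)
      show "span {x} \<subseteq> span ?F"
        by (rule span_mono) (auto intro: image_eqI[of _ _ 1])
    qed
    then have "dim ?F = dim {x}" by (metis dim_span)
    ultimately show ?thesis using assms(2) by simp
  qed
  ultimately show ?thesis by (simp add: edge_of_def)
qed

text \<open>
  The points \<open>2 a\<close> and \<open>2 b\<close> are the ends of a segment with midpoint \<open>\<rho>\<close>, so they belong to the face, which
  is one-dimensional and contains the origin.
\<close>

lemma summand_of_extremal_ray:
  assumes \<rho>: "\<rho> \<in> extremal_rays \<sigma>" and ab: "a \<in> \<sigma>" "b \<in> \<sigma>" "a + b = real_vec \<rho>"
  shows "\<exists>t. a = t *\<^sub>R real_vec \<rho>"
proof (cases "a = b")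
  case True
  then have "a = (1/2) *\<^sub>R real_vec \<rho>"
    using ab(3) by (simp flip: scaleR_2 add: ab(3)[symmetric])
  then show ?thesis by blast
next
  case False
  obtain F where F: "F face_of \<sigma>" "aff_dim F = 1" "real_vec \<rho> \<in> F"
    using \<rho> by (auto simp: extremal_rays_def edge_of_def)
  have "\<not> is_unit (2::int)" by simp
  then have \<rho>0: "\<rho> \<noteq> 0"
    using \<rho> by (auto simp: extremal_rays_def primitive_def dest: spec[of _ 2] spec[of _ 0])
  then have \<rho>0': "real_vec \<rho> \<noteq> 0" by simp
  have \<rho>\<sigma>: "real_vec \<rho> \<in> \<sigma>" using F(1,3) face_of_imp_subset by blast
  have "real_vec \<rho> \<in> open_segment 0 (2 *\<^sub>R real_vec \<rho>)"
    using \<rho>0' by (auto simp: in_segment intro!: exI[of _ "1/2::real"])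
  then have 0: "0 \<in> F"
    using F(1,3) \<rho>\<sigma> by (meson face_ofD scale_mem zero_mem zero_le_numeral)
  have "real_vec \<rho> \<in> open_segment (2 *\<^sub>R a) (2 *\<^sub>R b)"
    using False ab(3) by (auto simp: in_segment intro!: exI[of _ "1/2::real"])
  then have a: "2 *\<^sub>R a \<in> F"
    using F(1,3) ab(1,2) by (meson face_ofD scale_mem zero_le_numeral)
  have "collinear F" using F(2) by (simp add: collinear_aff_dim)
  then have "collinear {0, real_vec \<rho>, 2 *\<^sub>R a}"
    by (rule collinear_subset) (use F(3) 0 a in simp)
  then consider "a = 0" | c where "2 *\<^sub>R a = c *\<^sub>R real_vec \<rho>"
    using \<rho>0' by (auto simp: collinear_lemma)
  then show ?thesis
  proof cases
    case 1
    then show ?thesis by (auto intro: exI[of _ 0])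
  next
    case 2
    have "a = (1/2) *\<^sub>R (2 *\<^sub>R a)" by simp
    also have "\<dots> = (c / 2) *\<^sub>R real_vec \<rho>" unfolding 2 by simp
    finally show ?thesis by blast
  qed
qed

text \<open>
  Dually, this says that the cone is generated by its extremal rays. The slice by the hyperplane on which a positive functional
  \<open>u\<close> equals \<open>1\<close> is a polytope, so the theorem of Krein and Milman reduces the claim to its vertices;
  a vertex is a multiple of a lattice generator and spans an extremal ray.
\<close>

lemma mem_dual_monoid_if_nonneg_on_rays:
  assumes nonneg: "\<And>\<rho>. \<rho> \<in> extremal_rays \<sigma> \<Longrightarrow> 0 \<le> scalar_product m \<rho>"
  shows "m \<in> dual_monoid \<sigma>"
proof -
  obtain S where S: "finite S" "0 \<notin> S" "\<sigma> = convex_cone hull (real_vec ` S)"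
    by (rule generators)
  have S\<sigma>: "real_vec s \<in> \<sigma>" if "s \<in> S" for s
    using that S(3) by (simp add: hull_inc)
  obtain u where u: "\<And>x. x \<in> \<sigma> \<Longrightarrow> x \<noteq> 0 \<Longrightarrow> 0 < u \<bullet> x"
    using positive_functional_exists by blast
  have uS: "0 < u \<bullet> real_vec s" if "s \<in> S" for s
    using that u[OF S\<sigma>[OF that]] S(2) by auto
  define T where "T = (\<lambda>s. (1 / (u \<bullet> real_vec s)) *\<^sub>R real_vec s) ` S"
  define P where "P = convex hull T"
  have T: "t \<in> \<sigma>" "u \<bullet> t = 1" if "t \<in> T" for t
    using that uS S\<sigma> by (auto simp: T_def less_imp_le less_imp_neq[THEN not_sym] intro!: scale_mem)
  have P\<sigma>: "P \<subseteq> \<sigma>"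
    unfolding P_def using T(1) convex_cone by (intro hull_minimal) (auto simp: convex_cone_def)
  have Pu: "u \<bullet> x = 1" if "x \<in> P" for x
  proof -
    have "P \<subseteq> {x. u \<bullet> x = 1}"
      unfolding P_def using T(2) by (intro hull_minimal convex_hyperplane) auto
    then show ?thesis using that by auto
  qed
  have gen: "\<sigma> \<subseteq> convex_cone hull T"
    unfolding S(3)
  proof (rule hull_minimal)
    show "real_vec ` S \<subseteq> convex_cone hull T"
    proof
      fix x assume "x \<in> real_vec ` S"
      then obtain s where s: "s \<in> S" "x = real_vec s" by blast
      have "x = (u \<bullet> real_vec s) *\<^sub>R ((1 / (u \<bullet> real_vec s)) *\<^sub>R real_vec s)"
        using uS[OF s(1)] s(2) by simp
      moreover have "(1 / (u \<bullet> real_vec s)) *\<^sub>R real_vec s \<in> convex_cone hull T"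
        using s(1) by (intro hull_inc) (simp add: T_def)
      ultimately show "x \<in> convex_cone hull T"
        using uS[OF s(1)] by (metis convex_cone_hull_mul less_imp_le)
    qed
  qed (rule convex_cone_convex_cone_hull)
  have slice: "x \<in> P" if x: "x \<in> \<sigma>" "u \<bullet> x = 1" for x
  proof -
    have "x \<in> convex_cone hull T" "x \<noteq> 0" using x gen by auto
    then obtain c y where cy: "y \<in> P" "x = c *\<^sub>R y"
      unfolding convex_cone_hull_convex_hull P_def by auto
    then show ?thesis using x(2) Pu[OF cy(1)] by simp
  qed
  \<comment> \<open>Scaling \<open>x = a + b\<close> back into the slice makes \<open>x\<close> a convex combination with weights \<open>u \<bullet> a\<close> and
    \<open>u \<bullet> b\<close>, so extremality of \<open>x\<close> turns into indecomposability.\<close>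
  have extreme: "0 \<le> real_vec m \<bullet> x" if x: "x extreme_point_of P" for x
  proof -
    have xT: "x \<in> T" using x unfolding P_def by (rule extreme_point_of_convex_hull)
    then have x\<sigma>: "x \<in> \<sigma>" and ux: "u \<bullet> x = 1" by (auto simp: T)
    then have x0: "x \<noteq> 0" by auto
    have "\<exists>t\<ge>0. a = t *\<^sub>R x" if ab: "a \<in> \<sigma>" "b \<in> \<sigma>" "a + b = x" for a b
    proof -
      consider "a = 0" | "b = 0" | "a \<noteq> 0" "b \<noteq> 0" by blast
      then show ?thesis
      proof cases
        case 1 then show ?thesis by (auto intro: exI[of _ 0])
      next
        case 2 then show ?thesis using ab(3) by (auto intro: exI[of _ 1])
      next
        case 3
        then have pos: "0 < u \<bullet> a" "0 < u \<bullet> b" using u ab by auto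
        have sum1: "u \<bullet> a + u \<bullet> b = 1" using ux ab(3) by (simp flip: inner_add_right)
        let ?a = "(1 / (u \<bullet> a)) *\<^sub>R a" and ?b = "(1 / (u \<bullet> b)) *\<^sub>R b"
        have "?a \<in> P" "?b \<in> P"
          using pos ab by (auto intro!: slice scale_mem simp: less_imp_le)
        moreover have "x = (1 - u \<bullet> b) *\<^sub>R ?a + (u \<bullet> b) *\<^sub>R ?b"
        proof -
          have "1 - u \<bullet> b = u \<bullet> a" using sum1 by simp
          then show ?thesis using pos ab(3) by simp
        qed
        moreover have "u \<bullet> b < 1" using pos sum1 by simp
        ultimately have "?a = ?b"
          using x pos unfolding extreme_point_of_def in_segment by blast
        moreover have "x = (u \<bullet> a) *\<^sub>R ?a + (u \<bullet> b) *\<^sub>R ?b" using pos ab(3) by simp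
        ultimately have "x = (u \<bullet> a) *\<^sub>R ?a + (u \<bullet> b) *\<^sub>R ?a" by (simp only:)
        then have "x = ?a" by (metis scaleR_add_left scaleR_one sum1)
        then have "(u \<bullet> a) *\<^sub>R x = (u \<bullet> a) *\<^sub>R ?a" by (rule arg_cong)
        then have "a = (u \<bullet> a) *\<^sub>R x" using pos by simp
        then show ?thesis using pos by (metis less_imp_le)
      qed
    qed
    then have edge: "(\<lambda>t. t *\<^sub>R x) ` {0..} edge_of \<sigma>"
      by (rule ray_is_edge[OF x\<sigma> x0])
    obtain s where s: "s \<in> S" "x = (1 / (u \<bullet> real_vec s)) *\<^sub>R real_vec s"
      using xT by (auto simp: T_def)
    then have "s \<noteq> 0" using S(2) by auto
    then obtain c \<rho> where \<rho>: "c > 0" "primitive \<rho>" "s = c *s \<rho>"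
      by (rule lattice_vector_is_multiple_of_primitive)
    have xs: "x = (of_int c / (u \<bullet> real_vec s)) *\<^sub>R real_vec \<rho>"
      by (subst s(2), subst \<rho>(3), subst real_vec_scale) simp
    have k: "of_int c / (u \<bullet> real_vec s) > 0"
      using \<rho>(1) uS[OF s(1)] by simp
    define k where "k = of_int c / (u \<bullet> real_vec s)"
    have "real_vec \<rho> = (1 / k) *\<^sub>R x" "k > 0"
      using xs k by (auto simp: k_def)
    then have "real_vec \<rho> \<in> (\<lambda>t. t *\<^sub>R x) ` {0..}"
      by (auto intro!: image_eqI[of _ _ "1 / k"])
    then have "\<rho> \<in> extremal_rays \<sigma>"
      using edge \<rho>(2) by (auto simp: extremal_rays_def)
    then have "0 \<le> real_vec m \<bullet> real_vec \<rho>"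
      using nonneg by (simp add: real_vec_inner)
    then show ?thesis using \<open>k > 0\<close> xs by (simp flip: k_def)
  qed
  have "P = convex hull {x. x extreme_point_of P}"
    unfolding P_def T_def using S(1) by (intro Krein_Milman_polytope) simp
  also have "\<dots> \<subseteq> {x. 0 \<le> real_vec m \<bullet> x}"
    using extreme by (intro hull_minimal convex_halfspace_ge) auto
  finally have "T \<subseteq> {x. 0 \<le> real_vec m \<bullet> x}"
    using hull_subset[of T convex] unfolding P_def by blast
  then have "convex_cone hull T \<subseteq> {x. 0 \<le> real_vec m \<bullet> x}"
    by (intro hull_minimal convex_cone_halfspace_ge)
  then show ?thesis
    using gen by (auto simp: dual_monoid_def dual_cone_def)
qed

lemma extremal_ray_mem: "\<rho> \<in> extremal_rays \<sigma> \<Longrightarrow> real_vec \<rho> \<in> \<sigma>"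
  by (auto simp: extremal_rays_def dest: edge_of_imp_subset)

lemma ray_pairing_nonneg:
  assumes "\<rho> \<in> extremal_rays \<sigma>" "m \<in> dual_monoid \<sigma>"
  shows "0 \<le> scalar_product m \<rho>"
  using dual_monoid_nonneg[OF assms(2) extremal_ray_mem[OF assms(1)]]
  by (simp add: real_vec_inner)

text \<open>
  Adding a large multiple of an interior character makes any character nonnegative on the generators,
  so the dual monoid generates \<open>M\<close> as a group.
\<close>

lemma dual_monoid_spans:
  obtains s where "s \<in> dual_monoid \<sigma>" "m + s \<in> dual_monoid \<sigma>"
proof -
  obtain S where S: "finite S" "0 \<notin> S" "\<sigma> = convex_cone hull (real_vec ` S)"
    by (rule generators)
  obtain m0 where m0: "\<And>x. x \<in> \<sigma> \<Longrightarrow> x \<noteq> 0 \<Longrightarrow> 0 < real_vec m0 \<bullet> x"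
    using interior_character_exists by blast
  have "m0 \<in> dual_monoid \<sigma>"
    using m0 by (rule mem_dual_monoid_if_positive)
  define k where "k = (\<Sum>s\<in>S. \<bar>scalar_product m s\<bar>)"
  have "m + k *s m0 \<in> dual_monoid \<sigma>"
    unfolding dual_monoid_def dual_cone_def
  proof safe
    fix x assume "x \<in> \<sigma>"
    show "0 \<le> real_vec (m + k *s m0) \<bullet> x"
    proof (rule nonneg_if_nonneg_on_generators[OF S(3) _ \<open>x \<in> \<sigma>\<close>])
      fix s assume s: "s \<in> S"
      have "s \<noteq> 0" using s S(2) by auto
      moreover have "real_vec s \<in> \<sigma>" using s S(3) by (simp add: hull_inc)
      ultimately have "0 < real_vec m0 \<bullet> real_vec s"
        using m0 by auto
      then have "1 \<le> scalar_product m0 s" by (simp add: real_vec_inner)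
      moreover have k: "\<bar>scalar_product m s\<bar> \<le> k"
        unfolding k_def using S(1) s by (intro member_le_sum) auto
      ultimately have "k * 1 \<le> k * scalar_product m0 s"
        by (intro mult_left_mono) auto
      then have "0 \<le> scalar_product (m + k *s m0) s"
        using k by (simp add: scalar_product_add_left scalar_product_scale_left)
      then show "0 \<le> real_vec (m + k *s m0) \<bullet> real_vec s"
        by (simp add: real_vec_inner)
    qed
  qed
  moreover have "k *s m0 \<in> dual_monoid \<sigma>"
    using \<open>m0 \<in> _\<close> by (rule dual_monoid_scale) (simp add: k_def sum_nonneg)
  ultimately show ?thesis using that by blast
qed

text \<open>
  Since the dual monoid generates \<open>M\<close>, an additive function on it extends to the whole lattice.
\<close>

lemma additive_on_dual_monoid_eq_pairing:
  fixes f :: "int ^ 'n \<Rightarrow> int"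
  assumes add: "\<And>a b. a \<in> dual_monoid \<sigma> \<Longrightarrow> b \<in> dual_monoid \<sigma> \<Longrightarrow> f (a + b) = f a + f b"
  shows "\<exists>v. \<forall>m\<in>dual_monoid \<sigma>. f m = scalar_product m v"
proof -
  have "\<exists>s. s \<in> dual_monoid \<sigma> \<and> m + s \<in> dual_monoid \<sigma>" for m
    using dual_monoid_spans[of m] by blast
  then obtain s where s: "\<And>m. s m \<in> dual_monoid \<sigma>" "\<And>m. m + s m \<in> dual_monoid \<sigma>"
    by metis
  \<comment> \<open>The extension does not depend on the chosen \<open>s m\<close>, which is what the fact \<open>g\<close> below says.\<close>
  define g where "g m = f (m + s m) - f (s m)" for m
  have g: "g m = f (m + t) - f t" if "t \<in> dual_monoid \<sigma>" "m + t \<in> dual_monoid \<sigma>" for m t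
  proof -
    have "f (m + s m) + f t = f (m + t) + f (s m)"
      using add[OF s(2)[of m] that(1)] add[OF that(2) s(1)[of m]] by (simp add: ac_simps)
    then show ?thesis by (simp add: g_def)
  qed
  have "g (a + b) = g a + g b" for a b
  proof -
    have eq: "a + b + (s a + s b) = (a + s a) + (b + s b)" by (simp add: ac_simps)
    have "g (a + b) = f ((a + s a) + (b + s b)) - f (s a + s b)"
      unfolding eq[symmetric]
      by (rule g) (auto simp: eq intro!: dual_monoid_add s)
    then show ?thesis by (simp add: g_def add s)
  qed
  then have "g m = scalar_product m (\<chi> i. g (axis i 1))" for m
    by (rule additive_int_vec_eq_scalar_product)
  moreover have "f 0 = 0" using add[OF zero_mem_dual_monoid zero_mem_dual_monoid] by simp
  then have "f m = g m" if "m \<in> dual_monoid \<sigma>" for m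
    using g[of 0 m] that by (simp add: zero_mem_dual_monoid)
  ultimately show ?thesis by metis
qed

section \<open>Demazure roots\<close>

text \<open>
  This makes the prescribed exponential take values in the algebra: subtracting \<open>i\<close> from the pairing with
  \<open>\<rho>\<close> is harmless for \<open>i \<le> \<langle>m, \<rho>\<rangle>\<close>, and the pairings with the other rays do not decrease.
\<close>

lemma root_translate_mem:
  assumes \<rho>: "distinguished_ray \<sigma> e \<rho>" and m: "m \<in> dual_monoid \<sigma>" and i: "int i \<le> scalar_product m \<rho>"
  shows "m + int i *s e \<in> dual_monoid \<sigma>"
proof (rule mem_dual_monoid_if_nonneg_on_rays)
  fix \<rho>' assume \<rho>': "\<rho>' \<in> extremal_rays \<sigma>"
  show "0 \<le> scalar_product (m + int i *s e) \<rho>'"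
  proof (cases "\<rho>' = \<rho>")
    case True
    then show ?thesis
      using \<rho> i by (simp add: distinguished_ray_def scalar_product_add_left scalar_product_scale_left)
  next
    case False
    then have "0 \<le> scalar_product e \<rho>'" using \<rho> \<rho>' by (simp add: distinguished_ray_def)
    then show ?thesis
      using ray_pairing_nonneg[OF \<rho>' m] by (simp add: scalar_product_add_left scalar_product_scale_left)
  qed
qed

text \<open>
  The pairing of \<open>m + i e\<close> with a point of the cone is an affine function of \<open>i\<close>, hence bounded below by
  the smaller of its values at the ends of the string.
\<close>

lemma dual_monoid_string:
  assumes "m \<in> dual_monoid \<sigma>" "m + D *s e \<in> dual_monoid \<sigma>" "0 \<le> i" "i \<le> D"
  shows "m + i *s e \<in> dual_monoid \<sigma>"
proof -
  have "0 \<le> real_vec (m + i *s e) \<bullet> x" if "x \<in> \<sigma>" for x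
  proof (cases "0 \<le> real_vec e \<bullet> x")
    case True
    then show ?thesis
      using dual_monoid_nonneg[OF assms(1) that] assms(3)
      by (simp add: real_vec_add real_vec_scale inner_add_left)
  next
    case False
    then have "of_int D * (real_vec e \<bullet> x) \<le> of_int i * (real_vec e \<bullet> x)"
      using assms(4) by (intro mult_right_mono_neg) auto
    then show ?thesis
      using dual_monoid_nonneg[OF assms(2) that]
      by (simp add: real_vec_add real_vec_scale inner_add_left)
  qed
  then show ?thesis by (simp add: dual_monoid_def dual_cone_def)
qed

text \<open>
  The hypotheses say that the projection of \<open>M\<close> to the hyperplane \<open>v = 0\<close> along \<open>e\<close> preserves the dual
  monoid. Dually, the projection \<open>T w = w + \<langle>e, w\<rangle> v\<close> of \<open>N\<^sub>\<real>\<close> along \<open>v\<close> preserves the cone. If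
  \<open>v = a + b\<close> in the cone, then \<open>T a + T b = T v = 0\<close>, and strong convexity forces \<open>T a = 0\<close>, that is,
  \<open>a\<close> is a multiple of \<open>v\<close>; hence \<open>v\<close> spans an extremal ray. If \<open>\<langle>e, \<rho>\<rangle> = - k < 0\<close> for an extremal ray
  \<open>\<rho>\<close>, then \<open>\<rho> = T \<rho> + k v\<close> is a decomposition inside the cone, so \<open>v\<close> lies on that ray, and
  \<open>\<rho> = v\<close> as both are primitive.
\<close>

lemma distinguished_ray_criterion:
  assumes ev: "scalar_product e v = -1"
    and nonneg: "\<And>m. m \<in> dual_monoid \<sigma> \<Longrightarrow> 0 \<le> scalar_product m v"
    and proj: "\<And>m. m \<in> dual_monoid \<sigma> \<Longrightarrow> m + scalar_product m v *s e \<in> dual_monoid \<sigma>"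
  shows "distinguished_ray \<sigma> e v"
proof -
  have v: "real_vec v \<in> \<sigma>"
    using nonneg by (intro mem_if_nonneg_on_dual_monoid) (simp add: real_vec_inner)
  have "v \<noteq> 0" using ev by (auto simp: scalar_product_def)
  define T where "T w = w + (real_vec e \<bullet> w) *\<^sub>R real_vec v" for w
  have T: "T w \<in> \<sigma>" if "w \<in> \<sigma>" for w
  proof (rule mem_if_nonneg_on_dual_monoid)
    fix m assume "m \<in> dual_monoid \<sigma>"
    then have "0 \<le> real_vec (m + scalar_product m v *s e) \<bullet> w"
      using proj that dual_monoid_nonneg by blast
    then show "0 \<le> real_vec m \<bullet> T w"
      by (simp add: T_def real_vec_add real_vec_scale real_vec_inner inner_add_left inner_add_right mult.commute)
  qed
  have "\<exists>t\<ge>0. a = t *\<^sub>R real_vec v" if ab: "a \<in> \<sigma>" "b \<in> \<sigma>" "a + b = real_vec v" for a b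
  proof -
    have "T a + T b = T (real_vec v)"
      by (simp add: T_def ab(3)[symmetric] inner_add_right algebra_simps)
    also have "\<dots> = 0"
      by (simp add: T_def real_vec_inner ev)
    finally have "T a = 0" using T ab sum_eq_0_imp_eq_0 by blast
    then have Ta: "a + (real_vec e \<bullet> a) *\<^sub>R real_vec v = 0" by (simp add: T_def)
    then have a: "a = (- (real_vec e \<bullet> a)) *\<^sub>R real_vec v"
      by (simp add: eq_neg_iff_add_eq_0)
    define t where "t = - (real_vec e \<bullet> a)"
    have "t \<ge> 0"
    proof (rule ccontr)
      assume "\<not> t \<ge> 0"
      then have "(- t) *\<^sub>R real_vec v \<in> \<sigma>" by (intro scale_mem v) simp
      moreover have "a + (- t) *\<^sub>R real_vec v = 0" using Ta by (simp add: t_def)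
      ultimately have "a = 0" using ab(1) sum_eq_0_imp_eq_0 by blast
      then show False using \<open>\<not> t \<ge> 0\<close> by (simp add: t_def)
    qed
    then show ?thesis using a t_def by blast
  qed
  then have "(\<lambda>t. t *\<^sub>R real_vec v) ` {0..} edge_of \<sigma>"
    using \<open>v \<noteq> 0\<close> by (intro ray_is_edge v) simp_all
  moreover have "real_vec v \<in> (\<lambda>t. t *\<^sub>R real_vec v) ` {0..}"
    by (rule image_eqI[of _ _ 1]) simp_all
  ultimately have ray: "v \<in> extremal_rays \<sigma>"
    using primitive_if_pairing_is_minus_one[OF ev] unfolding extremal_rays_def by blast
  have "0 \<le> scalar_product e \<rho>" if \<rho>: "\<rho> \<in> extremal_rays \<sigma>" "\<rho> \<noteq> v" for \<rho>
  proof (rule ccontr)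
    assume "\<not> 0 \<le> scalar_product e \<rho>"
    define k where "k = - scalar_product e \<rho>"
    have k: "k > 0" using \<open>\<not> 0 \<le> _\<close> by (simp add: k_def)
    have "of_int k *\<^sub>R real_vec v + T (real_vec \<rho>) = real_vec \<rho>"
      by (simp add: T_def real_vec_inner k_def)
    moreover have "of_int k *\<^sub>R real_vec v \<in> \<sigma>" using k by (intro scale_mem v) simp
    moreover have "T (real_vec \<rho>) \<in> \<sigma>" using T extremal_ray_mem \<rho>(1) by blast
    ultimately obtain t where t: "of_int k *\<^sub>R real_vec v = t *\<^sub>R real_vec \<rho>"
      using summand_of_extremal_ray[OF \<rho>(1)] by blast
    have "of_int k * (real_vec e \<bullet> real_vec v) = t * (real_vec e \<bullet> real_vec \<rho>)"
      using arg_cong[OF t, of "\<lambda>w. real_vec e \<bullet> w"] by simp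
    then have "t = 1"
      using k by (simp add: real_vec_inner ev k_def)
    then have "\<rho> = k *s v"
      using t by (simp add: real_vec_scale[symmetric] real_vec_eq_iff)
    moreover from this have "is_unit k"
      using \<rho>(1) by (auto simp: extremal_rays_def primitive_def)
    then have "k = 1" using k by simp
    ultimately show False using \<rho>(2) by simp
  qed
  then show ?thesis
    using ray ev by (auto simp: distinguished_ray_def)
qed

end

section \<open>The semigroup algebra\<close>

lemma single_sum: "Poly_Mapping.single k (sum f X) = (\<Sum>x\<in>X. Poly_Mapping.single k (f x))"
  by (induction X rule: infinite_finite_induct) (simp_all add: single_add)

lemma poly_mapping_eq_sum_single: "f = (\<Sum>m\<in>Poly_Mapping.keys f. Poly_Mapping.single m (Poly_Mapping.lookup f m))"
  by (rule poly_mapping_eqI) (simp add: lookup_sum lookup_single when_def in_keys_iff)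

lemma eq_single_if_keys_subset:
  assumes "Poly_Mapping.keys f \<subseteq> {a}"
  shows "f = Poly_Mapping.single a (Poly_Mapping.lookup f a)"
  using assms by (intro poly_mapping_eqI) (auto simp: lookup_single when_def in_keys_iff)

lemma single_eq_0_iff [simp]: "Poly_Mapping.single m a = 0 \<longleftrightarrow> a = 0"
  by (metis lookup_single_eq lookup_zero single_zero)

lemma scale_single [simp]: "scale c (Poly_Mapping.single m a) = Poly_Mapping.single m (c * a)"
  by (simp add: scale_def mult_single)

lemma scale_add: "scale c (f + g) = scale c f + scale c g"
  by (simp add: scale_def algebra_simps)

lemma cone_algebra_single: "Poly_Mapping.single m a \<in> cone_algebra \<sigma> \<longleftrightarrow> m \<in> dual_monoid \<sigma> \<or> a = 0"
  by (simp add: cone_algebra_def)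

lemma cone_algebra_add: "f \<in> cone_algebra \<sigma> \<Longrightarrow> g \<in> cone_algebra \<sigma> \<Longrightarrow> f + g \<in> cone_algebra \<sigma>"
  using keys_add[of f g] by (auto simp: cone_algebra_def)

lemma cone_algebra_induct [consumes 1, case_names single add]:
  assumes "f \<in> cone_algebra \<sigma>"
    and single: "\<And>m a. m \<in> dual_monoid \<sigma> \<Longrightarrow> P (Poly_Mapping.single m a)"
    and add: "\<And>f g. f \<in> cone_algebra \<sigma> \<Longrightarrow> g \<in> cone_algebra \<sigma> \<Longrightarrow> P f \<Longrightarrow> P g \<Longrightarrow> P (f + g)"
  shows "P f"
proof -
  have "P 0" using single[OF zero_mem_dual_monoid, of 0] by simp
  have "(\<Sum>m\<in>X. Poly_Mapping.single m (Poly_Mapping.lookup f m)) \<in> cone_algebra \<sigma> \<and>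
        P (\<Sum>m\<in>X. Poly_Mapping.single m (Poly_Mapping.lookup f m))"
    if "finite X" "X \<subseteq> dual_monoid \<sigma>" for X
    using that
  proof (induction X rule: finite_induct)
    case empty
    then show ?case using \<open>P 0\<close> by (simp add: cone_algebra_def)
  next
    case (insert m X)
    then show ?case by (auto intro!: cone_algebra_add add single simp: cone_algebra_single)
  qed
  from this[of "Poly_Mapping.keys f"] show ?thesis
    using assms(1) by (simp add: cone_algebra_def poly_mapping_eq_sum_single[symmetric])
qed

section \<open>Binomial polynomials in positive characteristic\<close>

lemma coeff_binomial_power:
  fixes c :: "'k::comm_ring_1"
  assumes "q > 0"
  shows "coeff ((1 + monom c q) ^ n) k =
    (if q dvd k then of_nat (n choose (k div q)) * c ^ (k div q) else 0)"
proof -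
  have "(1 + monom c q) ^ n = (\<Sum>i\<le>n. of_nat (n choose i) * monom c q ^ i)"
    by (subst add.commute, subst binomial_ring) simp
  also have "\<dots> = (\<Sum>i\<le>n. monom (of_nat (n choose i) * c ^ i) (i * q))"
    by (intro sum.cong) (simp_all add: monom_power of_nat_poly smult_monom mult.commute)
  finally have "coeff ((1 + monom c q) ^ n) k = (\<Sum>i\<le>n. if i * q = k then of_nat (n choose i) * c ^ i else 0)"
    by (simp add: coeff_sum)
  also have "\<dots> = (if q dvd k then of_nat (n choose (k div q)) * c ^ (k div q) else 0)"
  proof (cases "q dvd k")
    case True
    then have "i * q = k \<longleftrightarrow> i = k div q" for i
      using assms by auto
    then show ?thesis using True by (simp add: binomial_eq_0)
  next
    case False
    then have "i * q \<noteq> k" for i by auto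
    then show ?thesis using False by simp
  qed
  finally show ?thesis .
qed

text \<open>
  The case of the congruence of Lucas that iterated operators need. It compares coefficients in
  \<open>(1 + x)\<^bsup>nq\<^esup> = (1 + x\<^sup>q)\<^sup>n\<close>, which holds for \<open>q\<close> a power of the characteristic.
\<close>

lemma binomial_char_power_multiple:
  fixes r :: nat
  assumes "CHAR('k::field) > 0"
  defines "q \<equiv> CHAR('k) ^ r"
  shows "(of_nat ((n * q) choose k) :: 'k) = (if q dvd k then of_nat (n choose (k div q)) else 0)"
proof -
  have "prime CHAR('k poly)"
    using prime_CHAR_semidom assms(1) by simp
  then have "(1 + monom 1 1 :: 'k poly) ^ q = 1 ^ q + monom 1 1 ^ q"
    by (rule freshmans_dream') (simp add: q_def)
  then have "(1 + monom 1 1 :: 'k poly) ^ (n * q) = (1 + monom 1 q) ^ n"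
    by (simp add: power_mult mult.commute[of n] monom_power)
  then have "coeff ((1 + monom 1 1 :: 'k poly) ^ (n * q)) k = coeff ((1 + monom 1 q) ^ n) k"
    by simp
  then show ?thesis
    using assms by (subst (asm) (1 2) coeff_binomial_power) simp_all
qed

text \<open>
  Both sides of the prescribed identity of exponentials are sums of this shape: \<open>q = 1\<close> for the
  exponential of an operator, \<open>q = p\<^sup>r\<close> for the binomial series.
\<close>

lemma coeff_Sum_any_monom:
  fixes g :: "nat \<Rightarrow> 'a::comm_ring_1"
  assumes "q > 0" and zero: "\<And>i. i \<ge> n \<Longrightarrow> g i = 0"
  shows "coeff (Sum_any (\<lambda>i. monom (g i) (i * q))) k = (if q dvd k then g (k div q) else 0)"
proof -
  have "Sum_any (\<lambda>i. monom (g i) (i * q)) = (\<Sum>i<n. monom (g i) (i * q))"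
    using zero by (intro Sum_any.expand_superset) (auto simp flip: not_le)
  then have "coeff (Sum_any (\<lambda>i. monom (g i) (i * q))) k = (\<Sum>i<n. if i * q = k then g i else 0)"
    by (simp add: coeff_sum)
  also have "\<dots> = (if q dvd k then g (k div q) else 0)"
  proof (cases "q dvd k")
    case True
    then have "i * q = k \<longleftrightarrow> i = k div q" for i
      using assms by auto
    then show ?thesis using True zero by simp
  next
    case False
    then have "i * q \<noteq> k" for i by auto
    then show ?thesis using False by simp
  qed
  finally show ?thesis .
qed

text \<open>
  The binomial series of \<open>m\<close> is the expansion of \<open>1 + c x\<^sup>q\<close> to the power \<open>\<langle>m, \<rho>\<rangle>\<close>.
  In this form multiplicativity in \<open>m\<close> is evident, so all computations with the exponential go
  through these polynomials. For \<open>k\<close> not divisible by \<open>q\<close> the coefficient is \<open>0\<close> and the rounding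
  in \<open>k div q\<close> does not matter.
\<close>

lemma has_root_exponentialI:
  fixes c :: "'k::field" and e \<rho> :: "int ^ 'n" and r :: nat
  defines "q \<equiv> CHAR('k) ^ r"
  assumes char: "CHAR('k) > 0"
    and d: "\<And>m k. m \<in> dual_monoid \<sigma> \<Longrightarrow> d k (character m) =
      Poly_Mapping.single (m + int (k div q) *s e)
        (coeff ((1 + monom c q) ^ nat (scalar_product m \<rho>)) k)"
  shows "has_root_exponential \<sigma> e \<rho> r c d"
  unfolding has_root_exponential_def
proof (intro ballI poly_eqI)
  fix m k assume m: "m \<in> dual_monoid \<sigma>"
  have q: "q > 0" using char by (simp add: q_def)
  let ?N = "nat (scalar_product m \<rho>)"
  have "coeff (hd_exp d (character m)) k = d k (character m)"
    using coeff_Sum_any_monom[of 1 "Suc (degree ((1 + monom c q) ^ ?N))" "\<lambda>i. d i (character m)" k]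
    by (simp add: hd_exp_def d[OF m] coeff_eq_0)
  also have "\<dots> = coeff (Sum_any (\<lambda>i. monom
      (scale (of_nat (?N choose i) * c ^ i) (character (m + int i *s e))) (i * q))) k"
    unfolding d[OF m]
    by (subst coeff_Sum_any_monom[OF q, of "Suc ?N"])
       (simp_all add: coeff_binomial_power[OF q] character_def binomial_eq_0)
  finally show "coeff (hd_exp d (character m)) k = coeff (Sum_any (\<lambda>i. monom
      (scale (of_nat (?N choose i) * c ^ i) (character (m + int i *s e))) (i * CHAR('k) ^ r))) k"
    by (simp add: q_def)
qed

section \<open>The operators of a Demazure root\<close>

text \<open>
  The \<open>k\<close>-linear extension of the prescribed action on characters, to all of \<open>k[M]\<close>. Outside the dual
  monoid the pairing with \<open>\<rho>\<close> may be negative; there \<^const>\<open>nat\<close> truncates and only linearity is kept.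
\<close>

definition root_operator ::
    "int ^ 'n \<Rightarrow> int ^ 'n \<Rightarrow> nat \<Rightarrow> 'k::field \<Rightarrow> nat \<Rightarrow> ((int ^ 'n) \<Rightarrow>\<^sub>0 'k) \<Rightarrow> ((int ^ 'n) \<Rightarrow>\<^sub>0 'k)" where
  "root_operator e \<rho> q c k f = (\<Sum>m\<in>Poly_Mapping.keys f.
     Poly_Mapping.single (m + int (k div q) *s e)
       (Poly_Mapping.lookup f m * coeff ((1 + monom c q) ^ nat (scalar_product m \<rho>)) k))"

lemma root_operator_superset:
  assumes "finite X" "Poly_Mapping.keys f \<subseteq> X"
  shows "root_operator e \<rho> q c k f = (\<Sum>m\<in>X.
     Poly_Mapping.single (m + int (k div q) *s e)
       (Poly_Mapping.lookup f m * coeff ((1 + monom c q) ^ nat (scalar_product m \<rho>)) k))"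
  unfolding root_operator_def using assms
  by (intro sum.mono_neutral_left) (auto simp: in_keys_iff)

lemma root_operator_add: "root_operator e \<rho> q c k (f + g) = root_operator e \<rho> q c k f + root_operator e \<rho> q c k g"
proof -
  let ?X = "Poly_Mapping.keys f \<union> Poly_Mapping.keys g"
  have "root_operator e \<rho> q c k h = (\<Sum>m\<in>?X.
     Poly_Mapping.single (m + int (k div q) *s e)
       (Poly_Mapping.lookup h m * coeff ((1 + monom c q) ^ nat (scalar_product m \<rho>)) k))"
    if "Poly_Mapping.keys h \<subseteq> ?X" for h
    using that by (intro root_operator_superset) auto
  note * = this
  show ?thesis
    by (subst (1 2 3) *)
       (auto simp: keys_add lookup_add distrib_right single_add sum.distrib intro: keys_add[THEN subsetD])
qed

lemma root_operator_single:
  "root_operator e \<rho> q c k (Poly_Mapping.single m a) =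
     Poly_Mapping.single (m + int (k div q) *s e) (a * coeff ((1 + monom c q) ^ nat (scalar_product m \<rho>)) k)"
  by (subst root_operator_superset[of "{m}"]) simp_all

lemma root_operator_zero [simp]: "root_operator e \<rho> q c k 0 = 0"
  by (simp add: root_operator_def)

text \<open>
  By linearity all identities need only be checked on monomials. There the Leibniz rule is
  multiplicativity of \<open>m \<mapsto> (1 + c x\<^sup>q)\<close> to the power \<open>\<langle>m, \<rho>\<rangle>\<close>, and the iteration rule combines
  \<open>(n choose j) (n - j choose i) = (i + j choose i) (n choose i + j)\<close> with the congruence of Lucas.
\<close>

lemma root_operator_lfihd:
  fixes c :: "'k::field" and \<sigma> :: "(real ^ 'n) set" and e \<rho> :: "int ^ 'n" and r :: nat
  assumes char: "CHAR('k) > 0"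
    and nonneg: "\<And>m. m \<in> dual_monoid \<sigma> \<Longrightarrow> 0 \<le> scalar_product m \<rho>"
    and e: "scalar_product e \<rho> = -1"
    and translate: "\<And>m i. m \<in> dual_monoid \<sigma> \<Longrightarrow> int i \<le> scalar_product m \<rho> \<Longrightarrow> m + int i *s e \<in> dual_monoid \<sigma>"
  defines "q \<equiv> CHAR('k) ^ r"
  defines "d \<equiv> root_operator e \<rho> q c"
  shows "lfihd scale (cone_algebra \<sigma>) d"
proof -
  have q: "q > 0" using char by (simp add: q_def)
  define E where "E m = (1 + monom c q) ^ nat (scalar_product m \<rho>)" for m
  have d_add: "d k (f + g) = d k f + d k g" for k f g
    by (simp add: d_def root_operator_add)
  have d_single: "d k (Poly_Mapping.single m a) = Poly_Mapping.single (m + int (k div q) *s e) (a * coeff (E m) k)" for k m a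
    by (simp add: d_def root_operator_single E_def)
  have d_zero [simp]: "d k 0 = 0" for k by (simp add: d_def)
  have E_coeff: "coeff (E m) k = (if q dvd k then of_nat (nat (scalar_product m \<rho>) choose (k div q)) * c ^ (k div q) else 0)" for m k
    unfolding E_def by (rule coeff_binomial_power[OF q])
  have E_nonzero: "q dvd k" "int (k div q) \<le> scalar_product m \<rho>" if "coeff (E m) k \<noteq> 0" "m \<in> dual_monoid \<sigma>" for m k
  proof -
    show "q dvd k" using that by (auto simp: E_coeff split: if_splits)
    have "k div q \<le> nat (scalar_product m \<rho>)"
    proof (rule ccontr)
      assume "\<not> k div q \<le> nat (scalar_product m \<rho>)"
      then have "coeff (E m) k = 0" by (simp add: E_coeff binomial_eq_0)
      then show False using that(1) by simp
    qed
    then show "int (k div q) \<le> scalar_product m \<rho>" using nonneg[OF that(2)] by linarith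
  qed
  have mem: "d k f \<in> cone_algebra \<sigma>" if "f \<in> cone_algebra \<sigma>" for k f
    using that
  proof (induction f rule: cone_algebra_induct)
    case (single m a)
    show ?case
    proof (cases "coeff (E m) k = 0")
      case False
      then show ?thesis
        using translate[OF single E_nonzero(2)[OF False single]] by (simp add: d_single cone_algebra_single)
    qed (simp add: d_single cone_algebra_def)
  qed (simp add: d_add cone_algebra_add)
  have scale: "d k (scale b f) = scale b (d k f)" if "f \<in> cone_algebra \<sigma>" for k b f
    using that
    by (induction f rule: cone_algebra_induct) (simp_all add: d_add scale_add d_single mult.assoc)
  have d0: "d 0 f = f" if "f \<in> cone_algebra \<sigma>" for f
    using that
    by (induction f rule: cone_algebra_induct) (simp_all add: d_add d_single E_coeff)
  have prod: "d k (Poly_Mapping.single m a * Poly_Mapping.single n b) =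
      (\<Sum>j=0..k. d j (Poly_Mapping.single m a) * d (k - j) (Poly_Mapping.single n b))"
    if m: "m \<in> dual_monoid \<sigma>" and n: "n \<in> dual_monoid \<sigma>" for k m n a b
  proof -
    have E_mult: "E (m + n) = E m * E n"
      using nonneg[OF m] nonneg[OF n]
      by (simp add: E_def scalar_product_add_left nat_add_distrib power_add)
    have "(\<Sum>j=0..k. d j (Poly_Mapping.single m a) * d (k - j) (Poly_Mapping.single n b)) =
      (\<Sum>j=0..k. Poly_Mapping.single (m + n + int (k div q) *s e) (a * b * (coeff (E m) j * coeff (E n) (k - j))))"
    proof (rule sum.cong)
      fix j assume j: "j \<in> {0..k}"
      show "d j (Poly_Mapping.single m a) * d (k - j) (Poly_Mapping.single n b) =
        Poly_Mapping.single (m + n + int (k div q) *s e) (a * b * (coeff (E m) j * coeff (E n) (k - j)))"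
      proof (cases "coeff (E m) j = 0 \<or> coeff (E n) (k - j) = 0")
        case True
        then show ?thesis by (auto simp: d_single mult_single)
      next
        case False
        then have "q dvd j" using E_nonzero(1)[of m j] m by blast
        then have "(j + (k - j)) div q = j div q + (k - j) div q"
          by (rule div_plus_div_distrib_dvd_left)
        then have "int (k div q) = int (j div q) + int ((k - j) div q)" using j by simp
        then have "int (k div q) *s e = int (j div q) *s e + int ((k - j) div q) *s e"
          by (simp only: vector_sadd_rdistrib)
        then show ?thesis by (simp add: d_single mult_single ac_simps)
      qed
    qed simp
    also have "\<dots> = Poly_Mapping.single (m + n + int (k div q) *s e) (a * b * coeff (E m * E n) k)"
      by (simp add: single_sum[symmetric] sum_distrib_left coeff_mult atMost_atLeast0)
    finally show ?thesis by (simp add: mult_single d_single E_mult)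
  qed
  have leibniz: "d k (f * g) = (\<Sum>j=0..k. d j f * d (k - j) g)"
    if "f \<in> cone_algebra \<sigma>" "g \<in> cone_algebra \<sigma>" for k f g
    using that(1)
  proof (induction f rule: cone_algebra_induct)
    case (single m a)
    show ?case using that(2)
      by (induction g rule: cone_algebra_induct)
         (simp_all add: prod single d_add distrib_left sum.distrib)
  qed (simp_all add: d_add distrib_right sum.distrib)
  have finite: "\<exists>n. \<forall>i\<ge>n. d i f = 0" if "f \<in> cone_algebra \<sigma>" for f
    using that
  proof (induction f rule: cone_algebra_induct)
    case (single m a)
    have "d i (Poly_Mapping.single m a) = 0" if "i \<ge> Suc (degree (E m))" for i
      using that by (simp add: d_single coeff_eq_0)
    then show ?case by blast
  next
    case (add f g)
    then obtain a b where "\<forall>i\<ge>a. d i f = 0" "\<forall>i\<ge>b. d i g = 0" by blast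
    then have "\<forall>i\<ge>max a b. d i (f + g) = 0" by (simp add: d_add)
    then show ?case by blast
  qed
  have iter: "d i (d j f) = of_nat ((i + j) choose i) * d (i + j) f" if "f \<in> cone_algebra \<sigma>" for i j f
    using that
  proof (induction f rule: cone_algebra_induct)
    case (single m a)
    have of_nat: "of_nat N * Poly_Mapping.single m' b = Poly_Mapping.single m' (of_nat N * b)"
      for N and m' :: "int ^ 'n" and b :: 'k
      by (simp only: of_nat_single o_apply mult_single add_0)
    define n where "n = nat (scalar_product m \<rho>)"
    let ?P = "coeff (E m) j * coeff (E (m + int (j div q) *s e)) i"
    \<comment> \<open>The nonvanishing part matters because the degrees on the two sides agree only when both indices
      are divisible by \<open>q\<close>.\<close>
    have coeffs: "of_nat ((i + j) choose i) * coeff (E m) (i + j) = coeff (E m) j * coeff (E (m + int (j div q) *s e)) i \<and>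
       (coeff (E m) j * coeff (E (m + int (j div q) *s e)) i \<noteq> 0 \<longrightarrow> q dvd i \<and> q dvd j)"
    proof (cases "q dvd j \<and> q dvd i")
      case True
      then obtain j' i' where j: "j = j' * q" and i: "i = i' * q" by (metis dvd_div_mult_self)
      have "nat (scalar_product (m + int (j div q) *s e) \<rho>) = n - j'"
        using q nonneg[OF single] by (simp add: j n_def scalar_product_add_left scalar_product_scale_left e nat_diff_distrib)
      moreover have "(of_nat ((i + j) choose i) :: 'k) = of_nat ((i' + j') choose i')"
        using binomial_char_power_multiple[OF char, of "i' + j'" r i] q
        by (simp add: i j flip: q_def distrib_right)
      moreover have "(n choose j') * ((n - j') choose i') = ((i' + j') choose i') * (n choose (i' + j'))"
      proof (cases "i' + j' \<le> n")
        case True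
        then have "(n choose (i' + j')) * ((i' + j') choose j') = (n choose j') * ((n - j') choose i')"
          using choose_mult[of j' "i' + j'" n] by (simp only: le_add2 diff_add_inverse2)
        moreover have "(i' + j') choose j' = (i' + j') choose i'"
          using binomial_symmetric[of i' "i' + j'"] by simp
        ultimately show ?thesis by (simp add: mult.commute)
      next
        case False
        then show ?thesis by (cases "j' \<le> n") (simp_all add: binomial_eq_0)
      qed
      then have "(of_nat (n choose j') * of_nat ((n - j') choose i') :: 'k) = of_nat ((i' + j') choose i') * of_nat (n choose (i' + j'))"
        by (metis of_nat_mult)
      moreover have "i + j = (i' + j') * q" by (simp add: i j distrib_right)
      then have "(i + j) div q = i' + j'" "q dvd i + j" "i div q = i'" "j div q = j'"
        using q by (simp_all add: i j)
      ultimately show ?thesis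
        using True by (simp add: E_coeff power_add ac_simps flip: n_def)
    next
      case False
      have "of_nat ((i + j) choose i) * coeff (E m) (i + j) = 0"
      proof (cases "q dvd i + j")
        case True
        then obtain N where N: "i + j = N * q" by (metis dvd_div_mult_self)
        have "\<not> q dvd i" using False True dvd_add_right_iff[of q i j] by blast
        then have "(of_nat ((i + j) choose i) :: 'k) = 0"
          using binomial_char_power_multiple[OF char, of N r i] by (simp add: N flip: q_def)
        then show ?thesis by simp
      qed (simp add: E_coeff)
      then show ?thesis using False by (auto simp: E_coeff)
    qed
    have exponents: "int ((i + j) div q) *s e = int (j div q) *s e + int (i div q) *s e" if "q dvd i" "q dvd j"
    proof -
      have "int ((i + j) div q) = int (j div q) + int (i div q)" using that by (simp add: div_plus_div_distrib_dvd_left)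
      then show ?thesis by (simp only: vector_sadd_rdistrib)
    qed
    have lhs: "d i (d j (Poly_Mapping.single m a)) =
        Poly_Mapping.single (m + (int (j div q) *s e + int (i div q) *s e))
          (a * ?P)"
      by (simp add: d_single mult.assoc add.assoc)
    have rhs: "of_nat ((i + j) choose i) * d (i + j) (Poly_Mapping.single m a) =
        Poly_Mapping.single (m + int ((i + j) div q) *s e) (a * (of_nat ((i + j) choose i) * coeff (E m) (i + j)))"
      by (simp add: d_single of_nat mult.left_commute)
    show ?case
    proof (cases "?P = 0")
      case True
      then show ?thesis unfolding lhs rhs coeffs[THEN conjunct1] True by simp
    next
      case False
      then have "q dvd i" "q dvd j" using coeffs by blast+
      then show ?thesis
        unfolding lhs rhs coeffs[THEN conjunct1] by (simp only: exponents)
    qed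
  qed (simp_all add: d_add distrib_left)
  show ?thesis
    unfolding lfihd_def using mem d_add scale d0 leibniz finite iter by blast
qed

lemma (in strongly_convex_rational_cone) root_lfihd_exists:
  fixes c :: "'k::field" and r :: nat
  assumes char: "CHAR('k) > 0" and ray: "distinguished_ray \<sigma> e \<rho>" and c: "c \<noteq> 0"
  shows "\<exists>d. lfihd scale (cone_algebra \<sigma> :: ((int ^ 'n) \<Rightarrow>\<^sub>0 'k) set) d \<and>
             nontrivial_hd (cone_algebra \<sigma>) d \<and> rationally_homogeneous \<sigma> d \<and>
             has_root_exponential \<sigma> e \<rho> r c d"
proof -
  define q where "q = CHAR('k) ^ r"
  have q: "q > 0" using char by (simp add: q_def)
  define d where "d = root_operator e \<rho> q c"
  have \<rho>: "\<rho> \<in> extremal_rays \<sigma>" and e: "scalar_product e \<rho> = -1"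
    using ray by (auto simp: distinguished_ray_def)
  have d_character: "d k (character m) = Poly_Mapping.single (m + int (k div q) *s e)
      (coeff ((1 + monom c q) ^ nat (scalar_product m \<rho>)) k)" for k m
    by (simp add: d_def character_def root_operator_single)
  have lfihd: "lfihd scale (cone_algebra \<sigma>) d"
    unfolding d_def q_def
    by (rule root_operator_lfihd[OF char ray_pairing_nonneg[OF \<rho>] e root_translate_mem[OF ray]])
  have \<chi>: "character m \<in> (cone_algebra \<sigma> :: ((int ^ 'n) \<Rightarrow>\<^sub>0 'k) set)" if "m \<in> dual_monoid \<sigma>" for m
    using that by (simp add: character_def cone_algebra_single)
  have "has_root_exponential \<sigma> e \<rho> r c d"
    using d_character by (intro has_root_exponentialI[OF char]) (simp add: q_def)
  moreover have "nontrivial_hd (cone_algebra \<sigma>) d"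
  proof -
    obtain m where pos: "\<And>x. x \<in> \<sigma> \<Longrightarrow> x \<noteq> 0 \<Longrightarrow> 0 < real_vec m \<bullet> x"
      using interior_character_exists by blast
    then have m: "m \<in> dual_monoid \<sigma>" by (rule mem_dual_monoid_if_positive)
    have "\<rho> \<noteq> 0" using e by (auto simp: scalar_product_def)
    then have "0 < scalar_product m \<rho>"
      using pos[OF extremal_ray_mem[OF \<rho>]] by (simp add: real_vec_inner)
    \<comment> \<open>The top coefficient is a power of \<open>c\<close>; lower ones may vanish in characteristic \<open>p\<close>.\<close>
    define k where "k = nat (scalar_product m \<rho>) * q"
    have "k > 0" using \<open>0 < scalar_product m \<rho>\<close> q by (simp add: k_def)
    moreover have "d k (character m) \<noteq> 0"
      using q c by (simp add: d_character coeff_binomial_power k_def)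
    ultimately have "character m \<notin> hd_kernel (cone_algebra \<sigma>) d"
      by (auto simp: hd_kernel_def)
    then show ?thesis using \<chi>[OF m] by (auto simp: nontrivial_hd_def)
  qed
  moreover have "rationally_homogeneous_of_degree \<sigma> e r d"
    unfolding rationally_homogeneous_of_degree_def q_def[symmetric]
  proof (intro conjI allI impI ballI)
    fix i m and f :: "(int ^ 'n) \<Rightarrow>\<^sub>0 'k"
    assume f: "f \<in> graded_piece \<sigma> m"
    then have "f = Poly_Mapping.single m (Poly_Mapping.lookup f m)"
      by (intro eq_single_if_keys_subset) (simp add: graded_piece_def)
    then have "d (i * q) f = Poly_Mapping.single (m + int i *s e)
        (Poly_Mapping.lookup f m * coeff ((1 + monom c q) ^ nat (scalar_product m \<rho>)) (i * q))"
      using q by (metis d_def div_mult_self_is_m root_operator_single)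
    moreover have "d (i * q) f \<in> cone_algebra \<sigma>"
      using f lfihd by (auto simp: lfihd_def graded_piece_def)
    ultimately show "d (i * q) f \<in> graded_piece \<sigma> (m + int i *s e)"
      by (simp add: graded_piece_def)
  next
    fix j and f :: "(int ^ 'n) \<Rightarrow>\<^sub>0 'k"
    assume j: "\<not> q dvd j"
    assume "f \<in> cone_algebra \<sigma>"
    show "d j f = 0"
      using j by (simp add: d_def root_operator_def coeff_binomial_power[OF q])
  qed
  ultimately show ?thesis
    using lfihd unfolding rationally_homogeneous_def by blast
qed

section \<open>The exponential of a homogeneous LFIHD\<close>

text \<open>
  Evaluating all characters of the exponential at \<open>1\<close> attaches to \<open>m\<close> a polynomial \<open>E m\<close> in \<open>x\<close>, and the
  Leibniz rule makes \<open>E\<close> multiplicative. Hence \<open>degree (E m)\<close> is additive and equals \<open>q \<langle>m, v\<rangle>\<close> for a vector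
  \<open>v\<close>. Applying the iteration rule after the operator of top order shows that \<open>E\<close> is \<open>1\<close> at
  \<open>m + \<langle>m, v\<rangle> e\<close>. Comparing degrees there gives \<open>\<langle>e, v\<rangle> = -1\<close>, and the geometric criterion makes \<open>v\<close> the
  distinguished ray of \<open>e\<close>. Finally \<open>E\<close> is determined by its value at one character \<open>m\<^sub>1\<close> with
  \<open>\<langle>m\<^sub>1, v\<rangle> = 1\<close>, which is of the form \<open>1 + c x\<^sup>q\<close>.
\<close>

lemma (in strongly_convex_rational_cone) lfihd_has_root_exponential:
  fixes d :: "nat \<Rightarrow> ((int ^ 'n) \<Rightarrow>\<^sub>0 'k::field) \<Rightarrow> ((int ^ 'n) \<Rightarrow>\<^sub>0 'k)" and r :: nat
  assumes char: "CHAR('k) > 0"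
    and d: "lfihd scale (cone_algebra \<sigma>) d"
    and nontrivial: "nontrivial_hd (cone_algebra \<sigma>) d"
    and hom: "rationally_homogeneous_of_degree \<sigma> e r d"
  shows "\<exists>v c. distinguished_ray \<sigma> e v \<and> c \<noteq> 0 \<and> has_root_exponential \<sigma> e v r c d"
proof -
  define q where "q = CHAR('k) ^ r"
  have q: "q > 0" using char by (simp add: q_def)
  let ?S = "dual_monoid \<sigma>"
  have \<chi>: "character m \<in> cone_algebra \<sigma>" if "m \<in> ?S" for m
    using that by (simp add: character_def cone_algebra_single)
  have d_scale: "d k (scale a f) = scale a (d k f)" and d0: "d 0 f = f"
    and d_iter: "d k (d j f) = of_nat ((k + j) choose k) * d (k + j) f"
    and d_fin: "\<exists>n. \<forall>i\<ge>n. d i f = 0" if "f \<in> cone_algebra \<sigma>" for k j a f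
    using d that unfolding lfihd_def by blast+
  have d_add: "d k (f + g) = d k f + d k g" and d_mult: "d k (f * g) = (\<Sum>j=0..k. d j f * d (k - j) g)"
    if "f \<in> cone_algebra \<sigma>" "g \<in> cone_algebra \<sigma>" for k f g
    using d that unfolding lfihd_def by blast+

  define b where "b k m = Poly_Mapping.lookup (d k (character m)) (m + int (k div q) *s e)" for k m
  have dk: "d k (character m) = Poly_Mapping.single (m + int (k div q) *s e) (b k m)" 
    and b_nonzero: "b k m \<noteq> 0 \<Longrightarrow> q dvd k \<and> m + int (k div q) *s e \<in> ?S"
    if m: "m \<in> ?S" for k m
  proof -
    consider i where "k = i * q" | "\<not> q dvd k" by (metis dvd_div_mult_self)
    then have "d k (character m) = Poly_Mapping.single (m + int (k div q) *s e) (b k m) \<and>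
      (b k m \<noteq> 0 \<longrightarrow> q dvd k \<and> m + int (k div q) *s e \<in> ?S)"
    proof cases
      case 1
      have "character m \<in> (graded_piece \<sigma> m :: ((int ^ 'n) \<Rightarrow>\<^sub>0 'k) set)"
        using \<chi>[OF m] by (simp add: graded_piece_def character_def)
      then have "d k (character m) \<in> graded_piece \<sigma> (m + int (k div q) *s e)"
        using hom q unfolding rationally_homogeneous_of_degree_def 1 q_def by simp
      then have keys: "Poly_Mapping.keys (d k (character m)) \<subseteq> {m + int (k div q) *s e} \<inter> ?S"
        by (simp add: graded_piece_def cone_algebra_def)
      then have "d k (character m) = Poly_Mapping.single (m + int (k div q) *s e) (b k m)"
        unfolding b_def by (intro eq_single_if_keys_subset) simp
      moreover from this keys have "m + int (k div q) *s e \<in> ?S" if "b k m \<noteq> 0"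
        using that by simp
      ultimately show ?thesis using 1 by simp
    next
      case 2
      then have "d k (character m) = 0"
        using hom \<chi>[OF m] unfolding rationally_homogeneous_of_degree_def q_def by blast
      then show ?thesis by (simp add: b_def)
    qed
    then show "d k (character m) = Poly_Mapping.single (m + int (k div q) *s e) (b k m)" 
      and "b k m \<noteq> 0 \<Longrightarrow> q dvd k \<and> m + int (k div q) *s e \<in> ?S" by blast+
  qed

  define E where "E m = Abs_poly (\<lambda>k. b k m)" for m
  have E_coeff: "coeff (E m) k = b k m" if m: "m \<in> ?S" for m k
  proof -
    obtain n where "\<forall>i\<ge>n. d i (character m) = 0" using d_fin[OF \<chi>[OF m]] by blast
    then have "coeff (Abs_poly (\<lambda>k. b k m)) = (\<lambda>k. b k m)"
      by (intro coeff_Abs_poly[of n]) (simp add: b_def)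
    then show ?thesis by (simp add: E_def)
  qed
  have E_0: "coeff (E m) 0 = 1" if m: "m \<in> ?S" for m
    using d0[OF \<chi>[OF m]] by (simp add: E_coeff[OF m] b_def character_def)
  have E_nonzero: "E m \<noteq> 0" if m: "m \<in> ?S" for m
    using E_0[OF m] by auto
  have E_mult: "E (m + n) = E m * E n" if m: "m \<in> ?S" and n: "n \<in> ?S" for m n
  proof (rule poly_eqI)
    fix k
    have mn: "m + n \<in> ?S" using m n by (rule dual_monoid_add)
    let ?x = "m + n + int (k div q) *s e"
    have "Poly_Mapping.single ?x (b k (m + n)) = d k (character m * character n)"
      using dk[OF mn] by (simp add: character_def mult_single)
    also have "\<dots> = (\<Sum>j=0..k. Poly_Mapping.single ?x (b j m * b (k - j) n))"
      unfolding d_mult[OF \<chi>[OF m] \<chi>[OF n]]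
    proof (rule sum.cong)
      fix j assume j: "j \<in> {0..k}"
      show "d j (character m) * d (k - j) (character n) = Poly_Mapping.single ?x (b j m * b (k - j) n)"
      proof (cases "b j m = 0 \<or> b (k - j) n = 0")
        case True
        then show ?thesis by (auto simp: dk[OF m] dk[OF n])
      next
        case False
        then have "q dvd j" using b_nonzero[OF m] by blast
        then have "(j + (k - j)) div q = j div q + (k - j) div q"
          by (rule div_plus_div_distrib_dvd_left)
        then have "int (k div q) = int (j div q) + int ((k - j) div q)" using j by simp
        then have "int (k div q) *s e = int (j div q) *s e + int ((k - j) div q) *s e"
          by (simp only: vector_sadd_rdistrib)
        then show ?thesis by (simp add: dk[OF m] dk[OF n] mult_single ac_simps)
      qed
    qed simp
    also have "\<dots> = Poly_Mapping.single ?x (coeff (E m * E n) k)"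
      by (simp add: single_sum[symmetric] coeff_mult atMost_atLeast0 E_coeff m n)
    finally show "coeff (E (m + n)) k = coeff (E m * E n) k"
      unfolding E_coeff[OF mn] by (metis lookup_single_eq)
  qed
  have E_power: "E (int N *s m) = E m ^ N" if m: "m \<in> ?S" for N m
  proof (induction N)
    case 0
    have "E 0 = E 0 * E 0" using E_mult[OF zero_mem_dual_monoid zero_mem_dual_monoid] by simp
    then show ?case using E_nonzero[OF zero_mem_dual_monoid] by simp
  next
    case (Suc N)
    then show ?case
      using E_mult[OF m dual_monoid_scale[OF m, of "int N"]] by (simp add: vector_sadd_rdistrib)
  qed

  define D where "D m = degree (E m) div q" for m
  have degree_E: "degree (E m) = q * D m" and top: "b (q * D m) m \<noteq> 0" if m: "m \<in> ?S" for m
  proof -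
    have top: "b (degree (E m)) m \<noteq> 0"
      using E_nonzero[OF m] leading_coeff_0_iff[of "E m"] by (simp add: E_coeff[OF m])
    then show "degree (E m) = q * D m"
      unfolding D_def using b_nonzero[OF m] by simp
    then show "b (q * D m) m \<noteq> 0" using top by simp
  qed
  have D_add: "int (D (m + n)) = int (D m) + int (D n)" if m: "m \<in> ?S" and n: "n \<in> ?S" for m n
  proof -
    have "q * D (m + n) = q * (D m + D n)"
      using degree_mult_eq[OF E_nonzero[OF m] E_nonzero[OF n]]
      by (simp add: E_mult[OF m n, symmetric] degree_E m n dual_monoid_add distrib_left)
    then show ?thesis using q by simp
  qed
  obtain v where v: "int (D m) = scalar_product m v" if "m \<in> ?S" for m
    using additive_on_dual_monoid_eq_pairing[of "\<lambda>m. int (D m)", OF D_add] by blast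

  \<comment> \<open>After the operator of top order \<open>q D m\<close> every further one gives zero, and the top coefficient is
    invertible.\<close>
  have endpoint: "m + int (D m) *s e \<in> ?S" "E (m + int (D m) *s e) = 1" if m: "m \<in> ?S" for m
  proof -
    let ?N = "q * D m" and ?m = "m + int (D m) *s e"
    show m': "?m \<in> ?S" using b_nonzero[OF m top[OF m]] q by simp
    have dN: "d ?N (character m) = scale (b ?N m) (character ?m)"
      unfolding dk[OF m] using q by (simp add: character_def)
    have "b i ?m = 0" if "i > 0" for i
    proof -
      have "b (i + ?N) m = 0"
        using that by (simp add: E_coeff[OF m, symmetric] coeff_eq_0 degree_E[OF m])
      then have "d i (d ?N (character m)) = 0"
        unfolding d_iter[OF \<chi>[OF m]] by (simp add: dk[OF m])
      then have "scale (b ?N m) (d i (character ?m)) = 0"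
        by (simp add: dN d_scale[OF \<chi>[OF m']])
      then show ?thesis using top[OF m] by (simp add: dk[OF m'])
    qed
    then have "coeff (E ?m) i = coeff 1 i" for i
      using E_0[OF m'] by (cases "i = 0") (simp_all add: E_coeff[OF m'])
    then show "E ?m = 1" by (simp add: poly_eq_iff)
  qed

  obtain m where m: "m \<in> ?S" "D m > 0"
  proof -
    \<comment> \<open>Linearity passes nontriviality on to some character.\<close>
    have "\<exists>m\<in>?S. \<exists>k>0. d k (character m) \<noteq> 0"
    proof (rule ccontr)
      assume none: "\<not> (\<exists>m\<in>?S. \<exists>k>0. d k (character m) \<noteq> 0)"
      have "d k f = 0" if "f \<in> cone_algebra \<sigma>" "k > 0" for k f
        using that(1)
      proof (induction f rule: cone_algebra_induct)
        case (single m a)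
        have "d k (character m) = 0" using none single \<open>k > 0\<close> by blast
        then have "d k (scale a (character m)) = scale a 0"
          by (simp only: d_scale[OF \<chi>[OF single]])
        then show ?case by (simp add: character_def) (simp add: scale_def)
      qed (simp add: d_add)
      then have "hd_kernel (cone_algebra \<sigma>) d = cone_algebra \<sigma>" by (auto simp: hd_kernel_def)
      then show False using nontrivial by (simp add: nontrivial_hd_def)
    qed
    then obtain m k where mk: "m \<in> ?S" "k > 0" "d k (character m) \<noteq> 0" by blast
    then have "coeff (E m) k \<noteq> 0" by (simp add: E_coeff dk)
    then have "degree (E m) > 0" using mk(2) le_degree[of "E m" k] by linarith
    then have "D m > 0" by (simp add: degree_E[OF mk(1)])
    then show ?thesis using that mk(1) by blast
  qed
  have ev: "scalar_product e v = -1"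
  proof -
    have "D (m + int (D m) *s e) = 0" using endpoint(2)[OF m(1)] by (simp add: D_def)
    then have "int (D m) * (1 + scalar_product e v) = 0"
      using v[OF endpoint(1)[OF m(1)]] v[OF m(1)]
      by (simp add: scalar_product_add_left scalar_product_scale_left distrib_left)
    then show ?thesis using m(2) by simp
  qed
  have ray: "distinguished_ray \<sigma> e v"
  proof (rule distinguished_ray_criterion[OF ev])
    fix n assume n: "n \<in> ?S"
    show "0 \<le> scalar_product n v" using v[OF n] by simp
    show "n + scalar_product n v *s e \<in> ?S" using endpoint(1)[OF n] v[OF n] by simp
  qed

  \<comment> \<open>The last element before the endpoint of the string through \<open>m\<close>; it lies in the monoid by convexity.\<close>
  define m\<^sub>1 where "m\<^sub>1 = m + (int (D m) - 1) *s e"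
  have m\<^sub>1: "m\<^sub>1 \<in> ?S"
    unfolding m\<^sub>1_def
    by (rule dual_monoid_string[OF m(1) endpoint(1)[OF m(1)]]) (use m(2) in simp_all)
  have "int (D m\<^sub>1) = scalar_product m\<^sub>1 v" by (rule v[OF m\<^sub>1])
  also have "\<dots> = scalar_product m v - (int (D m) - 1)"
    by (simp only: m\<^sub>1_def scalar_product_add_left scalar_product_scale_left ev) simp
  also have "\<dots> = 1" using v[OF m(1)] by simp
  finally have "int (D m\<^sub>1) = 1" .
  then have D1: "D m\<^sub>1 = 1" by simp
  then have deg1: "degree (E m\<^sub>1) = q" by (simp add: degree_E[OF m\<^sub>1])
  define c where "c = b q m\<^sub>1"
  have c: "c \<noteq> 0" using top[OF m\<^sub>1] by (simp add: c_def D1)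
  have E1: "E m\<^sub>1 = 1 + monom c q"
  proof (rule poly_eqI)
    fix k
    consider "k = 0" | "k = q" | "k > q" | "0 < k" "k < q" by linarith
    then show "coeff (E m\<^sub>1) k = coeff (1 + monom c q) k"
    proof cases
      case 1 then show ?thesis using q E_0[OF m\<^sub>1] by simp
    next
      case 2 then show ?thesis using q by (simp add: E_coeff[OF m\<^sub>1] c_def)
    next
      case 3 then show ?thesis using deg1 q by (simp add: coeff_eq_0)
    next
      case 4
      then have "\<not> q dvd k" using nat_dvd_not_less by blast
      then have "b k m\<^sub>1 = 0" using b_nonzero[OF m\<^sub>1] by blast
      then show ?thesis using 4 by (simp add: E_coeff[OF m\<^sub>1])
    qed
  qed
  have E_eq: "E n = (1 + monom c q) ^ nat (scalar_product n v)" if n: "n \<in> ?S" for n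
  proof -
    let ?N = "D n"
    have e1: "m\<^sub>1 + e \<in> ?S" "E (m\<^sub>1 + e) = 1" using endpoint[OF m\<^sub>1] D1 by simp_all
    \<comment> \<open>Compute \<open>E\<close> at \<open>n + D n (m\<^sub>1 + e) = (n + D n e) + D n m\<^sub>1\<close> in two ways; both \<open>m\<^sub>1 + e\<close> and
      \<open>n + D n e\<close> are endpoints of strings, where \<open>E\<close> is \<open>1\<close>.\<close>
    have "E n = E n * E (int ?N *s (m\<^sub>1 + e))"
      by (simp only: E_power[OF e1(1)] e1(2) power_one mult_1_right)
    also have "\<dots> = E (n + int ?N *s (m\<^sub>1 + e))"
      using n e1(1) by (intro E_mult[symmetric] dual_monoid_scale) simp_all
    also have "n + int ?N *s (m\<^sub>1 + e) = (n + int ?N *s e) + int ?N *s m\<^sub>1"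
      by (simp add: vector_add_ldistrib ac_simps)
    also have "E \<dots> = E (n + int ?N *s e) * E (int ?N *s m\<^sub>1)"
      using endpoint(1)[OF n] m\<^sub>1 by (intro E_mult dual_monoid_scale) simp_all
    also have "\<dots> = E m\<^sub>1 ^ ?N"
      by (simp add: endpoint(2)[OF n] E_power[OF m\<^sub>1])
    finally have "E n = E m\<^sub>1 ^ ?N" .
    moreover have "nat (scalar_product n v) = ?N" by (simp flip: v[OF n])
    ultimately show ?thesis by (simp add: E1)
  qed
  have "has_root_exponential \<sigma> e v r c d"
  proof (rule has_root_exponentialI[OF char])
    fix n k assume n: "n \<in> ?S"
    show "d k (character n) = Poly_Mapping.single (n + int (k div CHAR('k) ^ r) *s e)
        (coeff ((1 + monom c (CHAR('k) ^ r)) ^ nat (scalar_product n v)) k)"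
      using dk[OF n, of k] E_coeff[OF n, of k] by (simp add: E_eq[OF n] q_def)
  qed
  then show ?thesis using ray c by blast
qed

theorem corollary3p7:
  fixes \<sigma> :: "(real ^ 'n) set"
  assumes "CHAR('k::field) > 0"
    and "rational_cone \<sigma>" and "strongly_convex \<sigma>" and "\<sigma> \<noteq> {0}"
  shows "(\<forall>e\<in>demazure_roots \<sigma>. \<forall>\<rho> r. \<forall>c::'k. distinguished_ray \<sigma> e \<rho> \<and> c \<noteq> 0 \<longrightarrow>
           (\<exists>d. lfihd scale (cone_algebra \<sigma> :: ((int ^ 'n) \<Rightarrow>\<^sub>0 'k) set) d \<and>
                nontrivial_hd (cone_algebra \<sigma>) d \<and>
                rationally_homogeneous \<sigma> d \<and>
                has_root_exponential \<sigma> e \<rho> r c d)) \<and>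
         (\<forall>d. lfihd scale (cone_algebra \<sigma> :: ((int ^ 'n) \<Rightarrow>\<^sub>0 'k) set) d \<and>
              nontrivial_hd (cone_algebra \<sigma>) d \<and>
              rationally_homogeneous \<sigma> d \<longrightarrow>
           (\<exists>e\<in>demazure_roots \<sigma>. \<exists>\<rho> r. \<exists>c::'k. distinguished_ray \<sigma> e \<rho> \<and> c \<noteq> 0 \<and>
                has_root_exponential \<sigma> e \<rho> r c d))"
proof -
  interpret strongly_convex_rational_cone \<sigma>
    using assms(2,3) by unfold_locales
  show ?thesis
  proof (intro conjI ballI allI impI)
    fix e \<rho> r and c :: 'k
    assume "distinguished_ray \<sigma> e \<rho> \<and> c \<noteq> 0"
    then show "\<exists>d. lfihd scale (cone_algebra \<sigma> :: ((int ^ 'n) \<Rightarrow>\<^sub>0 'k) set) d \<and>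
        nontrivial_hd (cone_algebra \<sigma>) d \<and> rationally_homogeneous \<sigma> d \<and>
        has_root_exponential \<sigma> e \<rho> r c d"
      by (intro root_lfihd_exists[OF assms(1)]) simp_all
  next
    fix d :: "nat \<Rightarrow> ((int ^ 'n) \<Rightarrow>\<^sub>0 'k) \<Rightarrow> ((int ^ 'n) \<Rightarrow>\<^sub>0 'k)"
    assume d: "lfihd scale (cone_algebra \<sigma>) d \<and> nontrivial_hd (cone_algebra \<sigma>) d \<and>
        rationally_homogeneous \<sigma> d"
    then obtain e r where "rationally_homogeneous_of_degree \<sigma> e r d"
      unfolding rationally_homogeneous_def by blast
    then obtain \<rho> c where \<rho>: "distinguished_ray \<sigma> e \<rho>" "c \<noteq> 0" "has_root_exponential \<sigma> e \<rho> r c d"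
      using lfihd_has_root_exponential[OF assms(1)] d by meson
    then have "e \<in> demazure_roots \<sigma>" unfolding demazure_roots_def by blast
    with \<rho> show "\<exists>e\<in>demazure_roots \<sigma>. \<exists>\<rho> r. \<exists>c::'k. distinguished_ray \<sigma> e \<rho> \<and> c \<noteq> 0 \<and>
        has_root_exponential \<sigma> e \<rho> r c d"
      by blast
  qed
qed

end
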